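(* Assume that the law $P^{\xi_1}$ of the noise coordinates (not depending on $d$) is log-concave with a density $p=\exp(-\phi)$, where the finite convex potential $\phi$ satisfies, for a constant $c_+>0$, $\phi(tx+(1-t)y)-[t\phi(x)+(1-t)\phi(y)]\ge -\frac{c_+}{2}t(1-t)(x-y)^2$ for all $x,y\in\mathbb{R}$, $t\in(0,1)$. Let $\alpha=\alpha_d>0$, $a=a_d>0$, $1\le s=s_d\le d$, $n=n_d\ge1$ be such that $s/d\le C_0$ for some constant $C_0\in(0,1)$, and $\alpha/d\to0$ as $d\to\infty$. Suppose that one of the following holds: (i) $n\alpha^2/d^2\le C_1$ for some constant $C_1>0$ (and $a$ is arbitrary); (ii) $n\alpha^2/d^2\to\infty$ as $d\to\infty$ and $a^2\le C_2\,\sigma^2d^2/(n\alpha^2)$ for some constant $C_2>0$ depending only on $c_+$. Then there is a constant $C>0$, not depending on $d$, such that $\mathcal{R}^{CL}_n(\alpha,\Theta)\ge C$, both for $\Theta=\Theta_d^+(s,a)$ and for $\Theta=\Theta_d(s,a)$.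
   Context: "Constant" means not depending on $d$. Model: $\sigma>0$, $\theta\in\mathbb{R}^d$; $X^1,\dots,X^n$ are i.i.d. random vectors in $\mathbb{R}^d$ with law $P_\theta$, $X^i=\theta+\sigma\xi^i$, where $\xi^i$ has i.i.d. coordinates with law $P^{\xi_1}$ on $\mathbb{R}$, symmetric around $0$ and of variance $1$. $\Theta_d^+(s,a)$ (resp. $\Theta_d(s,a)$) is the set of $\theta\in\mathbb{R}^d$ for which there is $S\subseteq\{1,\dots,d\}$ with at most $s$ elements such that $\theta_j\ge a$ (resp. $|\theta_j|\ge a$) for $j\in S$ and $\theta_j=0$ for $j\notin S$. Put $\eta=(I(\theta_j\ne0))_{j=1,\dots,d}$ and, for $\hat\eta\in\{0,1\}^d$, $|\hat\eta-\eta|=\sum_{j=1}^d I(\hat\eta_j\neq\eta_j)$. A Markov kernel $Q$ is $\beta$-differentially private if $Q(A\mid x)\le e^{\beta}Q(A\mid x')$ for all measurable $A$ and all inputs $x,x'$. $\mathcal{Q}^{CL}_\alpha$ is the set of coordinate local mechanisms $Q=(Q^1,\dots,Q^n)$: each $Q^i$ is a product of coordinate-wise kernels, $Z^i_j\sim Q^i_j(\cdot\mid X^i_j)$ for $j=1,\dots,d$ (real-valued outputs, drawn independently over $j$ given $X^i$, and independently over $i$), where every $Q^i_j$ is $(\alpha/d)$-differentially private. The law of $(Z^1,\dots,Z^n)$ is denoted $Q(P_\theta^{\otimes n})$. A selector is a measurable map $\hat\eta=\hat\eta(Z^1,\dots,Z^n)\in\{0,1\}^d$; it is separable if for every $j$,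 $\hat\eta_j$ depends only on $(Z^i_j)_{i=1,\dots,n}$. $\mathcal{T}$ is the set of separable selectors. The minimax risk is $$\mathcal{R}^{CL}_n(\alpha,\Theta)=\inf_{Q\in\mathcal{Q}^{CL}_\alpha}\ \inf_{\hat\eta\in\mathcal{T}}\ \sup_{\theta\in\Theta}\ \frac1s\,\mathbb{E}_{Q(P_\theta^{\otimes n})}|\hat\eta-\eta| .$$ *)

theory Defs
  imports "HOL-Probability.Probability"
begin

text \<open>
  Coordinates are indexed by \<open>{..<d}\<close> and observations by \<open>{..<n}\<close>. A vector in $d$-space is an
  element of \<open>{..<d} \<rightarrow>\<^sub>E UNIV\<close>; a sample \<open>z\<close> has \<open>z i j\<close> as the \<open>j\<close>-th coordinate of its
  \<open>i\<close>-th observation.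
\<close>

definition Theta_plus :: "nat \<Rightarrow> nat \<Rightarrow> real \<Rightarrow> (nat \<Rightarrow> real) set" where
  "Theta_plus d s a = {\<theta> \<in> {..<d} \<rightarrow>\<^sub>E UNIV. \<exists>S\<subseteq>{..<d}. card S \<le> s \<and>
     (\<forall>j\<in>S. \<theta> j \<ge> a) \<and> (\<forall>j\<in>{..<d} - S. \<theta> j = 0)}"

definition Theta :: "nat \<Rightarrow> nat \<Rightarrow> real \<Rightarrow> (nat \<Rightarrow> real) set" where
  "Theta d s a = {\<theta> \<in> {..<d} \<rightarrow>\<^sub>E UNIV. \<exists>S\<subseteq>{..<d}. card S \<le> s \<and>
     (\<forall>j\<in>S. \<bar>\<theta> j\<bar> \<ge> a) \<and> (\<forall>j\<in>{..<d} - S. \<theta> j = 0)}"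

definition obs_space :: "nat \<Rightarrow> (nat \<Rightarrow> real) measure" where
  "obs_space d = PiM {..<d} (\<lambda>_. borel)"

definition sample_space :: "nat \<Rightarrow> nat \<Rightarrow> (nat \<Rightarrow> nat \<Rightarrow> real) measure" where
  "sample_space n d = PiM {..<n} (\<lambda>_. obs_space d)"

definition obs_law :: "real measure \<Rightarrow> real \<Rightarrow> nat \<Rightarrow> (nat \<Rightarrow> real) \<Rightarrow> (nat \<Rightarrow> real) measure" where
  "obs_law \<nu> \<sigma> d \<theta> =
     distr (PiM {..<d} (\<lambda>_. \<nu>)) (obs_space d) (\<lambda>\<xi>. \<lambda>j\<in>{..<d}. \<theta> j + \<sigma> * \<xi> j)"

definition sample_law ::
  "real measure \<Rightarrow> real \<Rightarrow> nat \<Rightarrow> nat \<Rightarrow> (nat \<Rightarrow> real) \<Rightarrow> (nat \<Rightarrow> nat \<Rightarrow> real) measure" where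
  "sample_law \<nu> \<sigma> n d \<theta> = PiM {..<n} (\<lambda>_. obs_law \<nu> \<sigma> d \<theta>)"

definition markov_kernel :: "'a measure \<Rightarrow> 'b measure \<Rightarrow> ('a \<Rightarrow> 'b measure) \<Rightarrow> bool" where
  "markov_kernel M N K \<longleftrightarrow> K \<in> M \<rightarrow>\<^sub>M prob_algebra N"

definition diff_private :: "real \<Rightarrow> 'a measure \<Rightarrow> 'b measure \<Rightarrow> ('a \<Rightarrow> 'b measure) \<Rightarrow> bool" where
  "diff_private \<beta> M N K \<longleftrightarrow> markov_kernel M N K \<and>
     (\<forall>A\<in>sets N. \<forall>x\<in>space M. \<forall>x'\<in>space M. measure (K x) A \<le> exp \<beta> * measure (K x') A)"

text \<open>A coordinate local mechanism is given by its coordinate kernels \<open>Q i j\<close>; only the values at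
  \<open>i < n\<close>, \<open>j < d\<close> matter.\<close>

definition CL_mechanisms :: "nat \<Rightarrow> nat \<Rightarrow> real \<Rightarrow> (nat \<Rightarrow> nat \<Rightarrow> real \<Rightarrow> real measure) set" where
  "CL_mechanisms n d \<alpha> = {Q. \<forall>i<n. \<forall>j<d. diff_private (\<alpha> / real d) borel borel (Q i j)}"

definition product_kernel ::
  "nat \<Rightarrow> nat \<Rightarrow> (nat \<Rightarrow> nat \<Rightarrow> real \<Rightarrow> real measure) \<Rightarrow>
    (nat \<Rightarrow> nat \<Rightarrow> real) \<Rightarrow> (nat \<Rightarrow> nat \<Rightarrow> real) measure" where
  "product_kernel n d Q x = PiM {..<n} (\<lambda>i. PiM {..<d} (\<lambda>j. Q i j (x i j)))"

definition private_law ::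
  "real measure \<Rightarrow> real \<Rightarrow> nat \<Rightarrow> nat \<Rightarrow> (nat \<Rightarrow> nat \<Rightarrow> real \<Rightarrow> real measure) \<Rightarrow>
    (nat \<Rightarrow> real) \<Rightarrow> (nat \<Rightarrow> nat \<Rightarrow> real) measure" where
  "private_law \<nu> \<sigma> n d Q \<theta> = sample_law \<nu> \<sigma> n d \<theta> \<bind> product_kernel n d Q"

definition selectors :: "nat \<Rightarrow> nat \<Rightarrow> ((nat \<Rightarrow> nat \<Rightarrow> real) \<Rightarrow> nat \<Rightarrow> nat) set" where
  "selectors n d = sample_space n d \<rightarrow>\<^sub>M PiM {..<d} (\<lambda>_. count_space {0, 1})"

definition separable_selectors :: "nat \<Rightarrow> nat \<Rightarrow> ((nat \<Rightarrow> nat \<Rightarrow> real) \<Rightarrow> nat \<Rightarrow> nat) set" where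
  "separable_selectors n d = {h \<in> selectors n d. \<forall>j<d.
     \<forall>z\<in>space (sample_space n d). \<forall>z'\<in>space (sample_space n d).
       (\<forall>i<n. z i j = z' i j) \<longrightarrow> h z j = h z' j}"

definition support_ind :: "(nat \<Rightarrow> real) \<Rightarrow> nat \<Rightarrow> nat" where
  "support_ind \<theta> j = (if \<theta> j \<noteq> 0 then 1 else 0)"

definition hamming_loss :: "nat \<Rightarrow> (nat \<Rightarrow> nat) \<Rightarrow> (nat \<Rightarrow> nat) \<Rightarrow> nat" where
  "hamming_loss d h \<eta> = (\<Sum>j<d. if h j \<noteq> \<eta> j then 1 else 0)"

text \<open>The loss is nonnegative, so its expectation is taken in the extended nonnegative reals, where
  the infima and the supremum always exist.\<close>

definition selection_risk ::
  "real measure \<Rightarrow> real \<Rightarrow> nat \<Rightarrow> nat \<Rightarrow> nat \<Rightarrow> (nat \<Rightarrow> nat \<Rightarrow> real \<Rightarrow> real measure) \<Rightarrow>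
    ((nat \<Rightarrow> nat \<Rightarrow> real) \<Rightarrow> nat \<Rightarrow> nat) \<Rightarrow> (nat \<Rightarrow> real) \<Rightarrow> ennreal" where
  "selection_risk \<nu> \<sigma> n d s Q h \<theta> = ennreal (1 / real s) *
     (\<integral>\<^sup>+ z. of_nat (hamming_loss d (h z) (support_ind \<theta>)) \<partial>private_law \<nu> \<sigma> n d Q \<theta>)"

definition CL_minimax_risk ::
  "real measure \<Rightarrow> real \<Rightarrow> nat \<Rightarrow> nat \<Rightarrow> nat \<Rightarrow> real \<Rightarrow> (nat \<Rightarrow> real) set \<Rightarrow> ennreal" where
  "CL_minimax_risk \<nu> \<sigma> n d s \<alpha> T =
     (INF Q\<in>CL_mechanisms n d \<alpha>. INF h\<in>separable_selectors n d.
        SUP \<theta>\<in>T. selection_risk \<nu> \<sigma> n d s Q h \<theta>)"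

text \<open>The variance clause entails square integrability: the Bochner integral of a non-integrable
  function is 0.\<close>

definition noise_law :: "real measure \<Rightarrow> bool" where
  "noise_law \<nu> \<longleftrightarrow> prob_space \<nu> \<and> sets \<nu> = sets borel \<and>
     distr \<nu> borel (\<lambda>x. - x) = \<nu> \<and> prob_space.variance \<nu> (\<lambda>x. x) = 1"

definition log_concave_potential :: "real measure \<Rightarrow> (real \<Rightarrow> real) \<Rightarrow> bool" where
  "log_concave_potential \<nu> \<phi> \<longleftrightarrow> convex_on UNIV \<phi> \<and>
     \<nu> = density lborel (\<lambda>x. ennreal (exp (- \<phi> x)))"

definition semiconcave :: "real \<Rightarrow> (real \<Rightarrow> real) \<Rightarrow> bool" where
  "semiconcave c \<phi> \<longleftrightarrow> (\<forall>x y t. 0 < t \<and> t < 1 \<longrightarrow>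
     \<phi> (t * x + (1 - t) * y) - (t * \<phi> x + (1 - t) * \<phi> y) \<ge> - (c / 2) * t * (1 - t) * (x - y)\<^sup>2)"

end

theory Submission
  imports Defs
begin

text \<open>
  For a separable selector the risk is a sum of errors of \<open>d\<close> scalar tests between \<open>\<theta> j = 0\<close> and
  \<open>\<theta> j = a\<close>, and some support of size \<open>s\<close> makes this sum at least its average over all supports; so it
  suffices to bound the sum of the two error probabilities of each test from below. Under both
  hypotheses the output of an \<open>\<epsilon>\<close>-private channel has nearly the same law: testing functions against a
  private kernel oscillate by at most a factor \<open>exp \<epsilon>\<close>, so the output laws differ by a relative
  error \<open>\<delta> = (exp \<epsilon> - 1) \<tau>\<close>, where \<open>\<tau> = min 1 (a / \<sigma> * p 0)\<close> bounds the total variation distance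
  between the noise and its shift by \<open>a / \<sigma>\<close>, since the density \<open>p\<close> is symmetric and unimodal. Thus the
  chi-square divergence of \<open>n\<close> outputs is at most \<open>(1 + \<delta>\<^sup>2) ^ n - 1\<close>, which is bounded when
  \<open>n * \<epsilon>\<^sup>2 * \<tau>\<^sup>2\<close> is.
\<close>

section \<open>Finite products of probability measures and Markov kernels\<close>

text \<open>Probability factors are asked for on \<open>I\<close> only, because a mechanism
  constrains its kernels \<open>Q i j\<close> only for \<open>i < n\<close> and
  \<open>j < d\<close>.\<close>

lemma PiM_eqI_prob:
  assumes "finite I" and M: "\<And>i. i \<in> I \<Longrightarrow> prob_space (M i)" and "sets P = sets (PiM I M)"
    and eq: "\<And>A. (\<And>i. i \<in> I \<Longrightarrow> A i \<in> sets (M i)) \<Longrightarrow>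
      emeasure P (Pi\<^sub>E I A) = (\<Prod>i\<in>I. emeasure (M i) (A i))"
  shows "P = PiM I M"
proof -
  \<comment> \<open>The locale \<open>product_prob_space\<close> wants a probability space at every
    index. A point mass is put outside \<open>I\<close>, which leaves the product over
    \<open>I\<close> unchanged.\<close>
  define N where "N i = (if i \<in> I then M i else return (count_space UNIV) undefined)" for i
  have N: "PiM I M = PiM I N"
    by (intro PiM_cong) (auto simp: N_def)
  interpret product_prob_space N
    by (rule product_prob_spaceI) (auto simp: N_def M intro!: prob_space_return)
  show ?thesis
    unfolding N by (rule PiM_eqI) (use assms N in \<open>auto simp: N_def\<close>)
qed

lemma emeasure_PiM_prob:
  assumes "finite I" and M: "\<And>i. i \<in> I \<Longrightarrow> prob_space (M i)"
    and A: "\<And>i. i \<in> I \<Longrightarrow> A i \<in> sets (M i)"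
  shows "emeasure (PiM I M) (Pi\<^sub>E I A) = (\<Prod>i\<in>I. emeasure (M i) (A i))"
proof -
  define N where "N i = (if i \<in> I then M i else return (count_space UNIV) undefined)" for i
  have N: "PiM I M = PiM I N"
    by (intro PiM_cong) (auto simp: N_def)
  interpret product_prob_space N
    by (rule product_prob_spaceI) (auto simp: N_def M intro!: prob_space_return)
  show ?thesis
    unfolding N by (subst emeasure_PiM) (use assms in \<open>auto simp: N_def\<close>)
qed

lemma nn_integral_PiM_prod:
  assumes "finite I" and M: "\<And>i. i \<in> I \<Longrightarrow> prob_space (M i)"
    and f: "\<And>i. i \<in> I \<Longrightarrow> f i \<in> borel_measurable (M i)"
  shows "(\<integral>\<^sup>+x. (\<Prod>i\<in>I. f i (x i)) \<partial>PiM I M) = (\<Prod>i\<in>I. \<integral>\<^sup>+x. f i x \<partial>M i)"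
proof -
  define N where "N i = (if i \<in> I then M i else return (count_space UNIV) undefined)" for i
  have N: "PiM I M = PiM I N"
    by (intro PiM_cong) (auto simp: N_def)
  interpret product_prob_space N
    by (rule product_prob_spaceI) (auto simp: N_def M intro!: prob_space_return)
  show ?thesis
    unfolding N by (subst product_nn_integral_prod) (use assms in \<open>auto simp: N_def\<close>)
qed

lemma distr_PiM_componentwise:
  assumes "finite I" and M: "\<And>i. i \<in> I \<Longrightarrow> prob_space (M i)"
    and f: "\<And>i. i \<in> I \<Longrightarrow> f i \<in> M i \<rightarrow>\<^sub>M N i"
  shows "distr (PiM I M) (PiM I N) (\<lambda>x. \<lambda>i\<in>I. f i (x i)) = PiM I (\<lambda>i. distr (M i) (N i) (f i))"
proof (rule PiM_eqI_prob)
  show "prob_space (distr (M i) (N i) (f i))" if "i \<in> I" for i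
    using that M f by (intro prob_space.prob_space_distr) auto
  show "sets (distr (PiM I M) (PiM I N) (\<lambda>x. \<lambda>i\<in>I. f i (x i))) =
      sets (PiM I (\<lambda>i. distr (M i) (N i) (f i)))"
    by (simp cong: sets_PiM_cong)
next
  fix A assume A: "\<And>i. i \<in> I \<Longrightarrow> A i \<in> sets (distr (M i) (N i) (f i))"
  have meas: "(\<lambda>x. \<lambda>i\<in>I. f i (x i)) \<in> PiM I M \<rightarrow>\<^sub>M PiM I N"
    using f by (intro measurable_restrict) (auto intro: measurable_compose[OF measurable_component_singleton])
  have "(\<lambda>x. \<lambda>i\<in>I. f i (x i)) -` (Pi\<^sub>E I A) \<inter> space (PiM I M) =
      Pi\<^sub>E I (\<lambda>i. f i -` A i \<inter> space (M i))"
    by (auto simp: space_PiM PiE_iff)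
  then have "emeasure (distr (PiM I M) (PiM I N) (\<lambda>x. \<lambda>i\<in>I. f i (x i))) (Pi\<^sub>E I A) =
      emeasure (PiM I M) (Pi\<^sub>E I (\<lambda>i. f i -` A i \<inter> space (M i)))"
    using A assms(1) by (subst emeasure_distr[OF meas]) (auto intro!: sets_PiM_I_finite)
  also have "\<dots> = (\<Prod>i\<in>I. emeasure (M i) (f i -` A i \<inter> space (M i)))"
    using A f by (intro emeasure_PiM_prob assms) (auto intro: measurable_sets)
  also have "\<dots> = (\<Prod>i\<in>I. emeasure (distr (M i) (N i) (f i)) (A i))"
    using A f by (intro prod.cong refl) (auto simp: emeasure_distr)
  finally show "emeasure (distr (PiM I M) (PiM I N) (\<lambda>x. \<lambda>i\<in>I. f i (x i))) (Pi\<^sub>E I A) =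
      (\<Prod>i\<in>I. emeasure (distr (M i) (N i) (f i)) (A i))" .
qed fact

text \<open>Rectangles form a generator closed under intersection, so measurability is checked on
  them alone; there the mass is a finite product of measurable functions.\<close>

lemma measurable_PiM_kernel:
  assumes I: "finite I" and K: "\<And>i. i \<in> I \<Longrightarrow> K i \<in> M i \<rightarrow>\<^sub>M prob_algebra (N i)"
  shows "(\<lambda>x. PiM I (\<lambda>i. K i (x i))) \<in> PiM I M \<rightarrow>\<^sub>M prob_algebra (PiM I N)"
proof (rule measurable_prob_algebra_generated[OF sets_PiM Int_stable_prod_algebra
      prod_algebra_sets_into_space])
  fix x assume x: "x \<in> space (PiM I M)"
  have Kx: "prob_space (K i (x i))" "sets (K i (x i)) = sets (N i)" if "i \<in> I" for i
    using measurable_space[OF K[OF that], of "x i"] x that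
    by (auto simp: space_prob_algebra space_PiM)
  show "prob_space (PiM I (\<lambda>i. K i (x i)))"
    by (rule prob_space_PiM) (rule Kx)
  show "sets (PiM I (\<lambda>i. K i (x i))) = sets (PiM I N)"
    by (intro sets_PiM_cong Kx refl)
next
  fix A assume "A \<in> prod_algebra I N"
  then obtain E where E: "A = Pi\<^sub>E I E" "E \<in> (\<Pi> i\<in>I. sets (N i))"
    by (auto simp: prod_algebra_eq_finite[OF I])
  have "emeasure (PiM I (\<lambda>i. K i (x i))) A = (\<Prod>i\<in>I. emeasure (K i (x i)) (E i))"
    if x: "x \<in> space (PiM I M)" for x
  proof -
    have "prob_space (K i (x i)) \<and> sets (K i (x i)) = sets (N i)" if "i \<in> I" for i
      using measurable_space[OF K[OF that], of "x i"] x that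
      by (auto simp: space_prob_algebra space_PiM)
    then show ?thesis
      unfolding E(1) using E(2) by (intro emeasure_PiM_prob I) auto
  qed
  moreover have "(\<lambda>x. \<Prod>i\<in>I. emeasure (K i (x i)) (E i)) \<in> borel_measurable (PiM I M)"
    using K E(2)
    by (intro borel_measurable_prod_ennreal measurable_compose[OF measurable_component_singleton]
        measurable_compose[OF _ measurable_emeasure_subprob_algebra] measurable_prob_algebraD) auto
  ultimately show "(\<lambda>x. emeasure (PiM I (\<lambda>i. K i (x i))) A) \<in> borel_measurable (PiM I M)"
    by (subst measurable_cong) auto
qed

text \<open>Independence survives a kernel acting factor by factor: the mass of a rectangle is the
  integral of a product of functions of separate factors, which factorises.\<close>

lemma bind_PiM_kernel:
  assumes I: "finite I" and M: "\<And>i. i \<in> I \<Longrightarrow> prob_space (M i)"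
    and K: "\<And>i. i \<in> I \<Longrightarrow> K i \<in> M i \<rightarrow>\<^sub>M prob_algebra (N i)"
  shows "PiM I M \<bind> (\<lambda>x. PiM I (\<lambda>i. K i (x i))) = PiM I (\<lambda>i. M i \<bind> K i)"
proof (rule PiM_eqI_prob[OF I])
  have Mi: "M i \<in> space (prob_algebra (M i))" if "i \<in> I" for i
    using that M by (auto simp: space_prob_algebra)
  have MM: "PiM I M \<in> space (prob_algebra (PiM I M))"
    using M by (auto simp: space_prob_algebra intro: prob_space_PiM)
  show "prob_space (M i \<bind> K i)" if "i \<in> I" for i
    using prob_space_bind'[OF Mi K] that by auto
  have *: "sets (M i \<bind> K i) = sets (N i)" if "i \<in> I" for i
    using sets_bind'[OF Mi K] that by auto
  then have "sets (PiM I (\<lambda>i. M i \<bind> K i)) = sets (PiM I N)"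
    by (intro sets_PiM_cong refl)
  then show "sets (PiM I M \<bind> (\<lambda>x. PiM I (\<lambda>i. K i (x i)))) = sets (PiM I (\<lambda>i. M i \<bind> K i))"
    using sets_bind'[OF MM measurable_PiM_kernel[OF I K]] by auto
  fix A assume A: "\<And>i. i \<in> I \<Longrightarrow> A i \<in> sets (M i \<bind> K i)"
  then have A': "A i \<in> sets (N i)" if "i \<in> I" for i using * that by auto
  have "emeasure (PiM I M \<bind> (\<lambda>x. PiM I (\<lambda>i. K i (x i)))) (Pi\<^sub>E I A) =
      (\<integral>\<^sup>+x. emeasure (PiM I (\<lambda>i. K i (x i))) (Pi\<^sub>E I A) \<partial>PiM I M)"
    using A' I by (intro emeasure_bind_prob_algebra[OF MM measurable_PiM_kernel[OF I K]])
      (auto intro!: sets_PiM_I_finite)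
  also have "\<dots> = (\<integral>\<^sup>+x. (\<Prod>i\<in>I. emeasure (K i (x i)) (A i)) \<partial>PiM I M)"
  proof (intro nn_integral_cong emeasure_PiM_prob I)
    fix x i assume "x \<in> space (PiM I M)" "i \<in> I"
    then have "K i (x i) \<in> space (prob_algebra (N i))"
      using measurable_space[OF K] by (auto simp: space_PiM)
    then show "prob_space (K i (x i))" "A i \<in> sets (K i (x i))"
      using A' \<open>i \<in> I\<close> by (auto simp: space_prob_algebra)
  qed
  also have "\<dots> = (\<Prod>i\<in>I. \<integral>\<^sup>+x. emeasure (K i x) (A i) \<partial>M i)"
    using K A' by (intro nn_integral_PiM_prod I M
        measurable_compose[OF _ measurable_emeasure_subprob_algebra] measurable_prob_algebraD) auto
  also have "\<dots> = (\<Prod>i\<in>I. emeasure (M i \<bind> K i) (A i))"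
    using A' by (intro prod.cong refl emeasure_bind_prob_algebra[OF Mi K, symmetric]) auto
  finally show "emeasure (PiM I M \<bind> (\<lambda>x. PiM I (\<lambda>i. K i (x i)))) (Pi\<^sub>E I A) =
      (\<Prod>i\<in>I. emeasure (M i \<bind> K i) (A i))" .
qed

section \<open>Shifts of a symmetric log-concave law\<close>

text \<open>A bathtub argument. The shifted density \<open>p (x - h)\<close> is at least
  \<open>p x\<close> to the right of \<open>h / 2\<close> and at most \<open>p x\<close> to the
  left, so the best function with values between 0 and \<open>w\<close> is \<open>w\<close> on the
  right half-line and 0 elsewhere. Its gain is \<open>w\<close> times the mass of an interval of
  length \<open>h\<close> around 0, where the density is at most \<open>p 0\<close>.\<close>

lemma log_concave_potential_shift:
  fixes G :: "real \<Rightarrow> real"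
  assumes nu: "noise_law \<nu>" and phi: "log_concave_potential \<nu> \<phi>" and h: "0 < h"
    and G [measurable]: "G \<in> borel_measurable borel" and G0: "\<And>x. 0 \<le> G x" and Gw: "\<And>x. G x \<le> w"
  shows "(\<integral>x. G (x + h) \<partial>\<nu>) - (\<integral>x. G x \<partial>\<nu>) \<le> w * (h * exp (- \<phi> 0))"
proof -
  define p where "p x = exp (- \<phi> x)" for x
  have conv: "convex_on UNIV \<phi>" and dens: "\<nu> = density lborel p"
    using phi by (auto simp: log_concave_potential_def p_def)
  have "continuous_on UNIV \<phi>"
    using conv by (intro convex_on_continuous) auto
  then have [measurable]: "\<phi> \<in> borel_measurable borel"
    by (rule borel_measurable_continuous_onI)
  have [measurable]: "p \<in> borel_measurable borel"
    unfolding p_def by measurable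
  have p0: "0 \<le> p x" for x by (simp add: p_def)
  have w: "0 \<le> w" using G0[of 0] Gw[of 0] by linarith
  interpret prob_space \<nu> using nu by (simp add: noise_law_def)
  have "(\<integral>\<^sup>+x. ennreal (p x) \<partial>lborel) = 1"
    using emeasure_space_1 unfolding dens by (simp add: emeasure_density)
  then have pint: "integrable lborel p"
    by (intro integrableI_nonneg) (auto simp: p0)
  have pint': "integrable lborel (\<lambda>x. p (x - h))"
    using lborel_integrable_real_affine[OF pint, of 1 "-h"] by simp
  have "distr \<nu> borel uminus = density lborel (\<lambda>x. p (- x))"
    unfolding dens using distr_density_distr[of "uminus :: real \<Rightarrow> real" lborel borel uminus "\<lambda>x. ennreal (p x)"]
    by (simp add: lborel_distr_uminus comp_def cong: distr_cong)
  then have "density lborel (\<lambda>x. p (- x)) = density lborel p"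
    using nu dens by (simp add: noise_law_def)
  \<comment> \<open>A law determines its density up to null sets, so symmetry yields evenness almost
    everywhere.\<close>
  then have even: "AE x in lborel. p (- x) = p x"
    by (subst (asm) sigma_finite_measure.density_unique_iff[OF sigma_finite_lborel])
      (auto simp: p_def)
  have even': "AE x in lborel. p (- (x - h)) = p (x - h)"
    using AE_borel_affine[OF _ _ even, of 1 "-h"] by (simp)
  \<comment> \<open>Evenness is required at the one point \<open>x\<close>, to fit evenness almost
    everywhere: between \<open>- x\<close> and \<open>x\<close> a convex function is at most the
    larger of its two end values.\<close>
  have mid: "p x \<le> p y" if "p (- x) = p x" "\<bar>y\<bar> \<le> \<bar>x\<bar>" for x y
  proof -
    have x: "\<phi> (- x) = \<phi> x" using that(1) by (simp add: p_def)
    have "y \<in> {-\<bar>x\<bar>..\<bar>x\<bar>}"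
      using that(2) by auto
    then have "\<phi> y \<le> max (\<phi> (- \<bar>x\<bar>)) (\<phi> \<bar>x\<bar>)"
      using conv by (intro convex_on_le_max) (auto intro: convex_on_subset)
    then have "\<phi> y \<le> \<phi> x"
      using x by (cases "0 \<le> x") auto
    then show ?thesis using x by (simp add: p_def)
  qed
  let ?I = "\<lambda>x. indicator {h/2<..} x :: real"
  have pG: "p y * G x \<le> w * p y" for x y
    using mult_left_mono[OF Gw p0] by (simp add: mult.commute)
  have Gint: "integrable lborel (\<lambda>x. p (x - h) * G x)" "integrable lborel (\<lambda>x. p x * G x)"
    by (rule Bochner_Integration.integrable_bound[OF integrable_mult_right[OF pint', of w]],
        use pG p0 G0 w in \<open>auto simp: abs_mult\<close>)
      (rule Bochner_Integration.integrable_bound[OF integrable_mult_right[OF pint, of w]],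
        use pG p0 G0 w in \<open>auto simp: abs_mult\<close>)
  have Iint: "integrable lborel (\<lambda>x. p (x - h) * ?I x)" "integrable lborel (\<lambda>x. p x * ?I x)"
     "integrable lborel (\<lambda>x. p x * ?I (x+h))"
    by (rule Bochner_Integration.integrable_bound[OF pint'],
        use p0 in \<open>auto simp: indicator_def\<close>)
      (rule Bochner_Integration.integrable_bound[OF pint],
        use p0 in \<open>auto simp: indicator_def\<close>)+
  have "(\<integral>x. G (x + h) \<partial>\<nu>) = (\<integral>x. p x * G (x + h) \<partial>lborel)"
    unfolding dens by (subst integral_density) (auto simp: p0)
  also have "\<dots> = (\<integral>x. p (x - h) * G x \<partial>lborel)"
    using lborel_integral_real_affine[of 1 "\<lambda>x. p (x - h) * G x" h] by (simp add: add.commute)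
  moreover have "(\<integral>x. G x \<partial>\<nu>) = (\<integral>x. p x * G x \<partial>lborel)"
    unfolding dens by (subst integral_density) (auto simp: p0)
  ultimately have "(\<integral>x. G (x + h) \<partial>\<nu>) - (\<integral>x. G x \<partial>\<nu>) =
      (\<integral>x. p (x - h) * G x - p x * G x \<partial>lborel)"
    using Gint by simp
  \<comment> \<open>Pointwise comparison with the best test: right of \<open>h / 2\<close> the
    density increment is nonnegative and \<open>G x \<le> w\<close>, left of it the increment is
    nonpositive and \<open>0 \<le> G x\<close>.\<close>
  also have "\<dots> \<le> (\<integral>x. w * (p (x - h) * ?I x - p x * ?I x) \<partial>lborel)"
  proof (rule integral_mono_AE)
    show "AE x in lborel. p (x - h) * G x - p x * G x \<le> w * (p (x - h) * ?I x - p x * ?I x)"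
      using even even'
    proof eventually_elim
      case (elim x)
      show ?case
      proof (cases "h / 2 < x")
        case True
        then have "p x \<le> p (x - h)"
          using elim h by (intro mid) auto
        then have "(p (x - h) - p x) * G x \<le> (p (x - h) - p x) * w"
          using Gw by (intro mult_left_mono) auto
        then show ?thesis using True by (simp add: algebra_simps)
      next
        case False
        then have "p (x - h) \<le> p x"
          using elim h by (intro mid) auto
        then show ?thesis using False G0 by (simp add: mult_right_mono)
      qed
    qed
  qed (use Gint Iint in auto)
  also have "\<dots> = w * ((\<integral>x. p (x - h) * ?I x \<partial>lborel) - (\<integral>x. p x * ?I x \<partial>lborel))"
    using Iint by simp
  \<comment> \<open>Translating back turns the difference of the two tails into the mass between
    \<open>- h / 2\<close> and \<open>h / 2\<close>.\<close>
  also have "(\<integral>x. p (x - h) * ?I x \<partial>lborel) = (\<integral>x. p x * ?I (x + h) \<partial>lborel)"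
    using lborel_integral_real_affine[of 1 "\<lambda>x. p (x - h) * ?I x" h] by (simp add: add.commute)
  also have "\<dots> - (\<integral>x. p x * ?I x \<partial>lborel) = (\<integral>x. p x * ?I (x + h) - p x * ?I x \<partial>lborel)"
    using Iint by simp
  also have "\<dots> \<le> (\<integral>x. p 0 * indicator {-h/2..h/2} x \<partial>lborel)"
  proof (rule integral_mono_AE)
    show "AE x in lborel. p x * ?I (x + h) - p x * ?I x \<le> p 0 * indicator {-h/2..h/2} x"
      using even
    proof eventually_elim
      case (elim x)
      have "p x \<le> p 0" using elim by (intro mid) auto
      then show ?case using h p0[of 0] by (auto simp: indicator_def field_simps)
    qed
  qed (use Iint h in auto)
  also have "\<dots> = h * exp (- \<phi> 0)"
    using h by (simp add: p_def)
  finally show ?thesis using w by (simp add: mult_left_mono)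
qed

section \<open>Chi-square domination and its behaviour under products\<close>

text \<open>This says that the chi-square divergence of \<open>P\<close> from \<open>P'\<close> is at most \<open>C - 1\<close>, phrased without
  densities so that it passes to products by Fubini's theorem.\<close>

definition square_dominated :: "real \<Rightarrow> 'a measure \<Rightarrow> 'a measure \<Rightarrow> bool" where
  "square_dominated C P P' \<longleftrightarrow> sets P = sets P' \<and>
     (\<forall>f\<in>borel_measurable P'. (\<forall>x. 0 \<le> f x \<and> f x \<le> 1) \<longrightarrow>
       (\<integral>x. f x \<partial>P)\<^sup>2 \<le> C * (\<integral>x. (f x)\<^sup>2 \<partial>P'))"

lemma (in prob_space) integral_in_unit_interval:
  fixes f :: "'a \<Rightarrow> real"
  assumes f: "\<And>x. 0 \<le> f x" "\<And>x. f x \<le> 1"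
  shows "0 \<le> integral\<^sup>L M f" and "integral\<^sup>L M f \<le> 1"
    and "f \<in> borel_measurable M \<Longrightarrow> integrable M f"
proof -
  show "0 \<le> integral\<^sup>L M f" using f by simp
  show "integral\<^sup>L M f \<le> 1"
    \<comment> \<open>A nonintegrable \<open>f\<close> has Bochner integral 0, so the bound covers
      it as well.\<close>
    using f integral_mono[of M f "\<lambda>_. 1"]
    by (cases "integrable M f") (auto simp: prob_space not_integrable_integral_eq)
  show "f \<in> borel_measurable M \<Longrightarrow> integrable M f"
    by (rule integrable_const_bound[of _ 1]) (use f in auto)
qed

text \<open>Applying the relative bound to the positive and negative parts of \<open>f\<close> minus its mean, rather than
  to \<open>f\<close>, makes the excess quadratic in \<open>\<delta>\<close>, which is what survives an \<open>n\<close>-fold product.\<close>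

lemma square_dominatedI_relative:
  fixes P P' :: "'a measure"
  assumes "prob_space P" "prob_space P'" and sets: "sets P = sets P'"
    and rel: "\<And>f::'a \<Rightarrow> real. f \<in> borel_measurable P' \<Longrightarrow> (\<And>x. 0 \<le> f x) \<Longrightarrow> (\<And>x. f x \<le> 1) \<Longrightarrow>
      \<bar>(\<integral>x. f x \<partial>P) - (\<integral>x. f x \<partial>P')\<bar> \<le> \<delta> * (\<integral>x. f x \<partial>P')"
    and \<delta>: "0 \<le> \<delta>"
  shows "square_dominated (1 + \<delta>\<^sup>2) P P'"
  unfolding square_dominated_def
proof (intro conjI ballI impI sets)
  interpret P: prob_space P by fact
  interpret P': prob_space P' by fact
  fix f :: "'a \<Rightarrow> real" assume f [measurable]: "f \<in> borel_measurable P'"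
    and f01: "\<forall>x. 0 \<le> f x \<and> f x \<le> 1"
  have [simp]: "borel_measurable P = borel_measurable P'"
    by (rule measurable_cong_sets[OF sets refl])
  define c where "c = (\<integral>x. f x \<partial>P')"
  have c: "0 \<le> c" "c \<le> 1"
    using P'.integral_in_unit_interval[of f] f01 by (auto simp: c_def)
  define u where "u x = max 0 (f x - c)" for x
  define v where "v x = max 0 (c - f x)" for x
  define r where "r = (\<integral>x. \<bar>f x - c\<bar> \<partial>P')"
  have [measurable]: "u \<in> borel_measurable P'" "v \<in> borel_measurable P'"
    unfolding u_def[abs_def] v_def[abs_def] by measurable
  have u: "0 \<le> u x" "u x \<le> 1" and v: "0 \<le> v x" "v x \<le> 1" for x
    using f01[rule_format, of x] c by (auto simp: u_def v_def)
  have fint: "integrable P f" "integrable P' f"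
    using f01 by (auto intro!: P.integral_in_unit_interval P'.integral_in_unit_interval)
  have uint: "integrable P u" "integrable P' u" "integrable P v" "integrable P' v"
    using u v by (auto intro!: P.integral_in_unit_interval P'.integral_in_unit_interval)
  have uv: "f x - c = u x - v x" "\<bar>f x - c\<bar> = u x + v x" for x
    by (auto simp: u_def v_def)
  have "(\<integral>x. f x \<partial>P) - c = (\<integral>x. f x - c \<partial>P)"
    using fint by (simp add: P.prob_space)
  also have "\<dots> = (\<integral>x. u x \<partial>P) - (\<integral>x. v x \<partial>P)"
    unfolding uv using uint by simp
  finally have 1: "(\<integral>x. f x \<partial>P) - c = (\<integral>x. u x \<partial>P) - (\<integral>x. v x \<partial>P)" .
  have "0 = (\<integral>x. f x - c \<partial>P')"
    using fint by (simp add: P'.prob_space c_def)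
  also have "\<dots> = (\<integral>x. u x \<partial>P') - (\<integral>x. v x \<partial>P')"
    unfolding uv using uint by simp
  finally have 2: "(\<integral>x. u x \<partial>P') = (\<integral>x. v x \<partial>P')" by simp
  have r: "r = (\<integral>x. u x \<partial>P') + (\<integral>x. v x \<partial>P')"
    unfolding r_def uv(2) using uint by simp
  \<comment> \<open>The equal means of \<open>u\<close> and \<open>v\<close> under \<open>P'\<close>
    cancel, and the two relative errors add up to \<open>\<delta> * r\<close>.\<close>
  have "(\<integral>x. f x \<partial>P) - c \<le> \<delta> * r"
    using rel[of u] rel[of v] u v unfolding 1 r by (auto simp: 2 algebra_simps abs_le_iff)
  then have le: "(\<integral>x. f x \<partial>P) \<le> c + \<delta> * r" by simp
  have f2: "integrable P' (\<lambda>x. (f x)\<^sup>2)"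
    using f01 by (intro P'.integral_in_unit_interval) (auto simp: power_le_one)
  \<comment> \<open>The variance of \<open>\<bar>f x - c\<bar>\<close> under \<open>P'\<close> is
    nonnegative, hence \<open>r\<^sup>2\<close> is at most the variance of \<open>f\<close>.\<close>
  have "(\<integral>x. (\<bar>f x - c\<bar> - r)\<^sup>2 \<partial>P') = (\<integral>x. (f x)\<^sup>2 - 2 * c * f x + c\<^sup>2 - 2 * r * \<bar>f x - c\<bar> + r\<^sup>2 \<partial>P')"
    by (intro Bochner_Integration.integral_cong refl) (auto simp: power2_eq_square algebra_simps abs_if)
  also have "\<dots> = (\<integral>x. (f x)\<^sup>2 \<partial>P') - 2 * c * c + c\<^sup>2 - 2 * r * r + r\<^sup>2"
    using fint f2 by (simp add: P'.prob_space flip: c_def r_def)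
  also have "\<dots> = (\<integral>x. (f x)\<^sup>2 \<partial>P') - c\<^sup>2 - r\<^sup>2"
    by (simp add: power2_eq_square)
  finally have cr: "c\<^sup>2 + r\<^sup>2 \<le> (\<integral>x. (f x)\<^sup>2 \<partial>P')"
    using Bochner_Integration.integral_nonneg[of P' "\<lambda>x. (\<bar>f x - c\<bar> - r)\<^sup>2"] by simp
  have "(\<integral>x. f x \<partial>P)\<^sup>2 \<le> (c + \<delta> * r)\<^sup>2"
    using le f01 by (intro power_mono) auto
  \<comment> \<open>Cauchy-Schwarz for the vectors \<open>(1, \<delta>)\<close> and
    \<open>(c, r)\<close>.\<close>
  also have "\<dots> \<le> (1 + \<delta>\<^sup>2) * (c\<^sup>2 + r\<^sup>2)"
    using zero_le_power2[of "\<delta> * c - r"] by (simp add: power2_eq_square algebra_simps)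
  also have "\<dots> \<le> (1 + \<delta>\<^sup>2) * (\<integral>x. (f x)\<^sup>2 \<partial>P')"
    using cr by (intro mult_left_mono) auto
  finally show "(\<integral>x. f x \<partial>P)\<^sup>2 \<le> (1 + \<delta>\<^sup>2) * (\<integral>x. (f x)\<^sup>2 \<partial>P')" .
qed

text \<open>Fubini twice: the bound for \<open>R\<close> is applied to each section of
  \<open>f\<close>, the bound for \<open>P\<close> to the section integral \<open>g\<close>, which
  is again a test function with values between 0 and 1.\<close>

lemma square_dominated_pair:
  assumes "prob_space P" "prob_space P'" "prob_space R" "prob_space R'"
    and P: "square_dominated C P P'" and R: "square_dominated D R R'" and C: "0 \<le> C"
  shows "square_dominated (C * D) (P \<Otimes>\<^sub>M R) (P' \<Otimes>\<^sub>M R')"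
  unfolding square_dominated_def
proof (intro conjI ballI impI)
  interpret P: prob_space P by fact
  interpret P': prob_space P' by fact
  interpret R: prob_space R by fact
  interpret R': prob_space R' by fact
  interpret PR: pair_prob_space P R ..
  interpret PR': pair_prob_space P' R' ..
  have s [measurable_cong]: "sets P = sets P'" "sets R = sets R'"
    using P R by (auto simp: square_dominated_def)
  show "sets (P \<Otimes>\<^sub>M R) = sets (P' \<Otimes>\<^sub>M R')"
    by (intro sets_pair_measure_cong s)
  fix f :: "'a \<times> 'b \<Rightarrow> real"
  assume f [measurable]: "f \<in> borel_measurable (P' \<Otimes>\<^sub>M R')" and f01: "\<forall>x. 0 \<le> f x \<and> f x \<le> 1"
  have f' [measurable]: "f \<in> borel_measurable (P \<Otimes>\<^sub>M R)"
    using f by (simp only: measurable_cong_sets[OF sets_pair_measure_cong[OF s] refl])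
  define g where "g x = (\<integral>y. f (x, y) \<partial>R)" for x
  have g [measurable]: "g \<in> borel_measurable P'"
    unfolding g_def[abs_def] by measurable
  have f2: "0 \<le> (f x)\<^sup>2" "(f x)\<^sup>2 \<le> 1" for x
    using power_le_one[of "f x" 2] f01[rule_format, of x] by auto
  have gx: "0 \<le> g x" "g x \<le> 1" for x
    using f01 R.integral_in_unit_interval[of "\<lambda>y. f (x, y)"] by (auto simp: g_def)
  have g2: "(g x)\<^sup>2 \<le> D * (\<integral>y. (f (x, y))\<^sup>2 \<partial>R')" if "x \<in> space P'" for x
  proof -
    have "(\<lambda>y. f (x, y)) \<in> borel_measurable R'"
      by (rule measurable_compose[OF measurable_Pair1'[OF that] f])
    then show ?thesis
      using R f01 by (simp add: square_dominated_def g_def)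
  qed
  have "(\<integral>z. f z \<partial>(P \<Otimes>\<^sub>M R))\<^sup>2 = (\<integral>x. g x \<partial>P)\<^sup>2"
    unfolding g_def using f01 f'
    by (subst PR.integral_fst') (auto intro!: PR.P.integral_in_unit_interval)
  also have "\<dots> \<le> C * (\<integral>x. (g x)\<^sup>2 \<partial>P')"
    using P gx g by (simp add: square_dominated_def)
  also have "\<dots> \<le> C * (\<integral>x. D * (\<integral>y. (f (x, y))\<^sup>2 \<partial>R') \<partial>P')"
  proof (intro mult_left_mono[OF _ C] integral_mono)
    have [measurable]: "(\<lambda>z. (f z)\<^sup>2) \<in> borel_measurable (P' \<Otimes>\<^sub>M R')" by measurable
    show "integrable P' (\<lambda>x. (g x)\<^sup>2)"
      using gx by (intro P'.integral_in_unit_interval) (auto simp: power_le_one)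
    show "integrable P' (\<lambda>x. D * (\<integral>y. (f (x, y))\<^sup>2 \<partial>R'))"
      using f2 by (intro integrable_mult_right PR'.integrable_fst' PR'.P.integral_in_unit_interval) auto
  qed (use g2 in auto)
  also have "\<dots> = C * D * (\<integral>z. (f z)\<^sup>2 \<partial>(P' \<Otimes>\<^sub>M R'))"
    using f2 by (simp, subst PR'.integral_fst') (auto intro!: PR'.P.integral_in_unit_interval)
  finally show "(\<integral>z. f z \<partial>(P \<Otimes>\<^sub>M R))\<^sup>2 \<le> C * D * (\<integral>z. (f z)\<^sup>2 \<partial>(P' \<Otimes>\<^sub>M R'))" .
qed

text \<open>Data processing: a test function composed with \<open>T\<close> is again a test
  function. This carries the bound from binary products to products over an index set.\<close>

lemma square_dominated_distr:
  assumes P: "square_dominated C P P'" and T: "T \<in> P' \<rightarrow>\<^sub>M N"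
  shows "square_dominated C (distr P N T) (distr P' N T)"
  unfolding square_dominated_def
proof (intro conjI ballI impI)
  fix f :: "_ \<Rightarrow> real" assume "f \<in> borel_measurable (distr P' N T)" and f01: "\<forall>x. 0 \<le> f x \<and> f x \<le> 1"
  then have f [measurable]: "f \<in> borel_measurable N" by simp
  have s: "sets P = sets P'" using P by (simp add: square_dominated_def)
  have T': "T \<in> P \<rightarrow>\<^sub>M N" using T by (simp only: measurable_cong_sets[OF s refl])
  have "(\<lambda>x. f (T x)) \<in> borel_measurable P'"
    by (rule measurable_compose[OF T f])
  then have "(\<integral>x. f (T x) \<partial>P)\<^sup>2 \<le> C * (\<integral>x. (f (T x))\<^sup>2 \<partial>P')"
    using P f01 by (simp add: square_dominated_def)
  moreover have "(\<lambda>x. (f x)\<^sup>2) \<in> borel_measurable N"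
    using f by measurable
  ultimately show "(\<integral>x. f x \<partial>distr P N T)\<^sup>2 \<le> C * (\<integral>x. (f x)\<^sup>2 \<partial>distr P' N T)"
    using integral_distr[OF T' f] integral_distr[OF T, of "\<lambda>x. (f x)\<^sup>2"] by simp
qed simp

lemma square_dominated_PiM:
  fixes P P' :: "'i \<Rightarrow> 'a measure"
  assumes "finite I" and "\<And>i. i \<in> I \<Longrightarrow> prob_space (P i)" "\<And>i. i \<in> I \<Longrightarrow> prob_space (P' i)"
    and "\<And>i. i \<in> I \<Longrightarrow> square_dominated C (P i) (P' i)" and C: "0 \<le> C"
  shows "square_dominated (C ^ card I) (PiM I P) (PiM I P')"
  using assms(1-4)
proof (induction I rule: finite_induct)
  case empty
  then show ?case
    by (auto simp: square_dominated_def PiM_empty lebesgue_integral_count_space_finite)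
next
  case (insert k I)
  have sk: "sets (P i) = sets (P' i)" if "i \<in> insert k I" for i
    using insert.prems(3)[OF that] by (simp add: square_dominated_def)
  let ?T = "\<lambda>(x, X). X(k := x)"
  have 1: "square_dominated (C ^ card I) (PiM I P) (PiM I P')"
    using insert by auto
  have "square_dominated (C * C ^ card I) (P k \<Otimes>\<^sub>M PiM I P) (P' k \<Otimes>\<^sub>M PiM I P')"
    using insert.prems C by (intro square_dominated_pair 1 prob_space_PiM) auto
  moreover have "?T \<in> P' k \<Otimes>\<^sub>M PiM I P' \<rightarrow>\<^sub>M PiM (insert k I) P'"
    by (subst measurable_split_conv) (rule measurable_fun_upd[where J=I]; auto)
  ultimately have "square_dominated (C ^ card (insert k I))
      (distr (P k \<Otimes>\<^sub>M PiM I P) (PiM (insert k I) P') ?T)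
      (distr (P' k \<Otimes>\<^sub>M PiM I P') (PiM (insert k I) P') ?T)"
    using insert.hyps by (auto intro!: square_dominated_distr)
  \<comment> \<open>Both images had to be formed in one target space; a target enters only through
    its sigma-algebra, so \<open>P'\<close> can be exchanged for \<open>P\<close> there.\<close>
  also have "distr (P k \<Otimes>\<^sub>M PiM I P) (PiM (insert k I) P') ?T =
      distr (P k \<Otimes>\<^sub>M PiM I P) (PiM (insert k I) P) ?T"
    using sk by (intro distr_cong sets_PiM_cong) auto
  also have "\<dots> = PiM (insert k I) P"
    using insert.prems by (intro distr_pair_PiM_eq_PiM) auto
  also have "distr (P' k \<Otimes>\<^sub>M PiM I P') (PiM (insert k I) P') ?T = PiM (insert k I) P'"
    using insert.prems by (intro distr_pair_PiM_eq_PiM) auto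
  finally show ?case .
qed

lemma square_dominated_measure:
  assumes P: "square_dominated C P P'" and A: "A \<in> sets P'"
  shows "(measure P A)\<^sup>2 \<le> C * measure P' A"
proof -
  have "sets P = sets P'" using P by (simp add: square_dominated_def)
  then have "A \<subseteq> space P" "A \<subseteq> space P'"
    using A sets.sets_into_space by blast+
  moreover have "(\<integral>x. indicator A x \<partial>P)\<^sup>2 \<le> C * (\<integral>x. (indicator A x)\<^sup>2 \<partial>P')"
    using P A unfolding square_dominated_def
    by (meson borel_measurable_indicator indicator_pos_le indicator_le_1)
  moreover have "(\<lambda>x. (indicator A x)\<^sup>2) = (indicator A :: _ \<Rightarrow> real)"
    by (auto simp: indicator_def)
  ultimately show ?thesis by (simp add: Int_absorb2)
qed

section \<open>A single private channel\<close>

text \<open>The law of one private output in a coordinate where the signal equals \<open>t\<close>;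
  the whole problem is reduced to this scalar experiment.\<close>

definition channel_law :: "real measure \<Rightarrow> real \<Rightarrow> (real \<Rightarrow> real measure) \<Rightarrow> real \<Rightarrow> real measure" where
  "channel_law \<nu> \<sigma> K t = distr \<nu> borel (\<lambda>x. t + \<sigma> * x) \<bind> K"

lemma channel_input_prob_algebra:
  assumes "noise_law \<nu>"
  shows "distr \<nu> borel (\<lambda>x. t + \<sigma> * x) \<in> space (prob_algebra borel)"
  using assms unfolding noise_law_def space_prob_algebra
  by (auto intro!: prob_space.prob_space_distr)

lemma channel_law_prob_space:
  assumes "noise_law \<nu>" and "K \<in> borel \<rightarrow>\<^sub>M prob_algebra borel"
  shows "prob_space (channel_law \<nu> \<sigma> K t)" and "sets (channel_law \<nu> \<sigma> K t) = sets borel"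
  unfolding channel_law_def
  using prob_space_bind'[OF channel_input_prob_algebra assms(2)]
    sets_bind'[OF channel_input_prob_algebra assms(2)] assms(1) by auto

text \<open>Privacy on events places \<open>K x\<close> below the measure \<open>K x'\<close> scaled
  by \<open>exp \<epsilon>\<close>, and integrals of nonnegative functions are monotone in the
  measure.\<close>

lemma diff_private_integral_le:
  assumes K: "diff_private \<epsilon> borel borel K"
    and f: "f \<in> borel_measurable borel" "\<And>x. 0 \<le> f x" "\<And>x. f x \<le> 1"
  shows "(\<integral>z. f z \<partial>K x) \<le> exp \<epsilon> * (\<integral>z. f z \<partial>K x')"
proof -
  have "K y \<in> space (prob_algebra borel)" for y
    using K unfolding diff_private_def markov_kernel_def by (auto dest: measurable_space)
  then have p: "prob_space (K y)" and s: "sets (K y) = sets borel" for y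
    by (auto simp: space_prob_algebra)
  have fm: "f \<in> borel_measurable (K y)" for y
    using f(1) by (simp only: measurable_cong_sets[OF s refl])
  have fint: "integrable (K y) f" for y
    using fm f by (intro prob_space.integral_in_unit_interval(3)[OF p]) auto
  have le: "K x \<le> density (K x') (\<lambda>_. ennreal (exp \<epsilon>))"
  proof (subst le_measure)
    show "\<forall>A\<in>sets (K x). emeasure (K x) A \<le> emeasure (density (K x') (\<lambda>_. ennreal (exp \<epsilon>))) A"
    proof
      fix A assume "A \<in> sets (K x)"
      then have A: "A \<in> sets borel" "A \<in> sets (K x')" using s by auto
      have "measure (K x) A \<le> exp \<epsilon> * measure (K x') A"
        using K A by (auto simp: diff_private_def)
      then show "emeasure (K x) A \<le> emeasure (density (K x') (\<lambda>_. ennreal (exp \<epsilon>))) A"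
        using A finite_measure.emeasure_eq_measure[OF prob_space.finite_measure[OF p]]
        by (simp add: emeasure_density_const ennreal_mult[symmetric] ennreal_leI)
    qed
  qed (simp add: s)
  have "(\<integral>\<^sup>+z. f z \<partial>K x) \<le> (\<integral>\<^sup>+z. f z \<partial>density (K x') (\<lambda>_. ennreal (exp \<epsilon>)))"
    by (rule nn_integral_mono_measure) (simp_all add: s le)
  also have "\<dots> = ennreal (exp \<epsilon>) * (\<integral>\<^sup>+z. f z \<partial>K x')"
    using fm by (simp add: nn_integral_density nn_integral_cmult)
  finally show ?thesis
    using f fint by (simp add: nn_integral_eq_integral ennreal_mult[symmetric])
qed

text \<open>For a test function \<open>f\<close>, privacy confines its mean \<open>F x\<close> given
  the input \<open>x\<close> to the range from \<open>m\<close> to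
  \<open>exp \<epsilon> * m\<close>, where \<open>m\<close> is the infimum. So \<open>F\<close>
  oscillates by at most \<open>w\<close>, and shifting the noise moves the average of
  \<open>F\<close> by at most \<open>w * \<tau>\<close>. As \<open>w\<close> is proportional to
  \<open>m\<close>, which is at most that average, the error is relative.\<close>

lemma private_channel_square_dominated:
  assumes nu: "noise_law \<nu>" and phi: "log_concave_potential \<nu> \<phi>" and \<sigma>: "0 < \<sigma>" and a: "0 < a"
    and \<epsilon>: "0 \<le> \<epsilon>" and K: "diff_private \<epsilon> borel borel K"
  shows "square_dominated (1 + ((exp \<epsilon> - 1) * min 1 (a / \<sigma> * exp (- \<phi> 0)))\<^sup>2)
    (channel_law \<nu> \<sigma> K a) (channel_law \<nu> \<sigma> K 0)"
proof (rule square_dominatedI_relative)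
  have Km: "K \<in> borel \<rightarrow>\<^sub>M prob_algebra borel"
    using K by (simp add: diff_private_def markov_kernel_def)
  then have Km' [measurable]: "K \<in> borel \<rightarrow>\<^sub>M subprob_algebra borel"
    by (rule measurable_prob_algebraD)
  show "prob_space (channel_law \<nu> \<sigma> K a)" "prob_space (channel_law \<nu> \<sigma> K 0)"
    and "sets (channel_law \<nu> \<sigma> K a) = sets (channel_law \<nu> \<sigma> K 0)"
    using channel_law_prob_space[OF nu Km] by auto
  have c: "borel_measurable (channel_law \<nu> \<sigma> K t) = borel_measurable borel" for t
    by (rule measurable_cong_sets[OF channel_law_prob_space(2)[OF nu Km] refl])
  let ?\<tau> = "min 1 (a / \<sigma> * exp (- \<phi> 0))"
  show "0 \<le> (exp \<epsilon> - 1) * ?\<tau>" using \<epsilon> \<sigma> a by simp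
  interpret nu: prob_space \<nu> using nu by (simp add: noise_law_def)
  have nus [measurable_cong]: "sets \<nu> = sets borel" using nu by (simp add: noise_law_def)
  fix f :: "real \<Rightarrow> real"
  assume f: "f \<in> borel_measurable (channel_law \<nu> \<sigma> K 0)" and f01: "\<And>x. 0 \<le> f x" "\<And>x. f x \<le> 1"
  have f [measurable]: "f \<in> borel_measurable borel" using f unfolding c .
  define F where "F x = (\<integral>z. f z \<partial>K x)" for x
  have Kx: "K x \<in> space (prob_algebra borel)" for x
    using Km by (auto dest: measurable_space)
  have F01: "0 \<le> F x" "F x \<le> 1" for x
    using prob_space.integral_in_unit_interval[of "K x" f] Kx[of x] f01
    by (auto simp: F_def space_prob_algebra)
  have F [measurable]: "F \<in> borel_measurable borel"
    unfolding F_def[abs_def]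
    by (rule measurable_compose[OF Km' integral_measurable_subprob_algebra]) (rule f)
  have Fle: "F x \<le> exp \<epsilon> * F x'" for x x'
    unfolding F_def by (rule diff_private_integral_le[OF K f f01])
  have int: "(\<integral>z. f z \<partial>channel_law \<nu> \<sigma> K t) = (\<integral>x. F (t + \<sigma> * x) \<partial>\<nu>)" for t
  proof -
    have "(\<integral>z. f z \<partial>channel_law \<nu> \<sigma> K t) = (\<integral>x. F x \<partial>distr \<nu> borel (\<lambda>x. t + \<sigma> * x))"
      unfolding channel_law_def F_def
    proof (rule integral_bind[where B=1 and B'=1 and K=borel])
      show "AE x in distr \<nu> borel (\<lambda>x. t + \<sigma> * x). emeasure (K x) (space (K x)) \<le> ennreal 1"
        using Kx by (intro AE_I2) (auto simp: space_prob_algebra prob_space.emeasure_space_1)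
      show "finite_measure (distr \<nu> borel (\<lambda>x. t + \<sigma> * x))"
        using channel_input_prob_algebra[OF nu]
        by (auto simp: space_prob_algebra prob_space.finite_measure)
    qed (use f01 in \<open>auto simp: Km'\<close>)
    then show ?thesis by (simp add: integral_distr)
  qed
  define m where "m = (INF x. F x)"
  have bdd: "bdd_below (range F)" using F01 by (intro bdd_belowI[of _ 0]) auto
  have mF: "m \<le> F x" for x
    unfolding m_def by (rule cINF_lower[OF bdd]) simp
  have m0: "0 \<le> m"
    unfolding m_def using F01 by (intro cINF_greatest) auto
  have Fm: "F x \<le> exp \<epsilon> * m" for x
  proof -
    have "F x / exp \<epsilon> \<le> m"
      unfolding m_def using Fle by (intro cINF_greatest) (auto simp: field_simps)
    then show ?thesis by (simp add: field_simps)
  qed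
  define w where "w = (exp \<epsilon> - 1) * m"
  have w0: "0 \<le> w" using \<epsilon> m0 by (simp add: w_def)
  define G where "G x = F (\<sigma> * x) - m" for x
  have G0: "0 \<le> G x" for x using mF by (simp add: G_def)
  have Gw: "G x \<le> w" for x using Fm[of "\<sigma> * x"] by (simp add: G_def w_def algebra_simps)
  have G [measurable]: "G \<in> borel_measurable borel" unfolding G_def[abs_def] by measurable
  have Gi: "integrable \<nu> (\<lambda>x. G (x + h))" for h
    by (rule nu.integrable_const_bound[of _ w]) (use G0 Gw in auto)
  define I where "I h = (\<integral>x. G (x + h) \<partial>\<nu>)" for h
  have FI: "(\<integral>x. F (t + \<sigma> * x) \<partial>\<nu>) = I (t / \<sigma>) + m" for t
  proof -
    have "(\<integral>x. F (t + \<sigma> * x) \<partial>\<nu>) = (\<integral>x. G (x + t / \<sigma>) + m \<partial>\<nu>)"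
    proof -
      have "t + \<sigma> * x = \<sigma> * (x + t / \<sigma>)" for x
        using \<sigma> by (simp add: distrib_left)
      then show ?thesis by (simp only: G_def diff_add_cancel)
    qed
    then show ?thesis using Gi by (simp add: I_def nu.prob_space)
  qed
  have Ib: "0 \<le> I h" "I h \<le> w" for h
    using integral_mono[OF Gi[of h], of "\<lambda>_. w"] G0 Gw by (auto simp: I_def nu.prob_space)
  let ?h = "a / \<sigma>"
  have "I ?h - I 0 \<le> w * (?h * exp (- \<phi> 0))"
    using log_concave_potential_shift[OF nu phi _ G G0 Gw, of ?h] a \<sigma> by (simp add: I_def)
  \<comment> \<open>The reverse direction follows from the shift bound for \<open>w - G\<close>,
    which has the same range.\<close>
  moreover have "I 0 - I ?h \<le> w * (?h * exp (- \<phi> 0))"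
  proof -
    have "(\<lambda>x. w - G x) \<in> borel_measurable borel" by measurable
    from log_concave_potential_shift[OF nu phi _ this, of ?h w]
    have "(\<integral>x. w - G (x + ?h) \<partial>\<nu>) - (\<integral>x. w - G x \<partial>\<nu>) \<le> w * (?h * exp (- \<phi> 0))"
      using G0 Gw a \<sigma> by auto
    then show ?thesis
      using Gi[of ?h] Gi[of 0] by (simp add: I_def nu.prob_space)
  qed
  \<comment> \<open>The trivial bound accounts for the 1 in the minimum, which handles arbitrarily
    large \<open>a\<close>.\<close>
  moreover have "\<bar>I ?h - I 0\<bar> \<le> w" using Ib[of ?h] Ib[of 0] by auto
  ultimately have "\<bar>I ?h - I 0\<bar> \<le> w * ?\<tau>"
    by (auto simp: min_def)
  \<comment> \<open>Here \<open>I 0 + m\<close> is the mean of \<open>f\<close> in the absence of a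
    signal, and it is at least \<open>m\<close>.\<close>
  also have "\<dots> \<le> (exp \<epsilon> - 1) * ?\<tau> * (I 0 + m)"
    using Ib[of 0] \<epsilon> a \<sigma> by (simp add: w_def algebra_simps mult_mono)
  finally show "\<bar>(\<integral>z. f z \<partial>channel_law \<nu> \<sigma> K a) - (\<integral>z. f z \<partial>channel_law \<nu> \<sigma> K 0)\<bar> \<le>
      (exp \<epsilon> - 1) * ?\<tau> * (\<integral>z. f z \<partial>channel_law \<nu> \<sigma> K 0)"
    unfolding int FI by simp
qed

section \<open>Averaging over supports and an elementary testing bound\<close>

text \<open>Deleting an element with the least value never lowers the average; this is repeated
  until \<open>s\<close> elements remain.\<close>

lemma exists_subset_sum_ge_average:
  fixes D :: "'a \<Rightarrow> real"
  assumes "finite V" and "s \<le> card V"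
  shows "\<exists>S\<subseteq>V. card S = s \<and> real s * sum D V \<le> real (card V) * sum D S"
  using assms
proof (induction "card V - s" arbitrary: V)
  case 0
  then show ?case by (intro exI[of _ V]) auto
next
  case (Suc k)
  then have V: "finite V" "V \<noteq> {}" "s < card V" by auto
  define v where "v = arg_min_on D V"
  have v: "v \<in> V" and vmin: "\<And>x. x \<in> V \<Longrightarrow> D v \<le> D x"
    using arg_min_if_finite(1)[OF V(1,2)] arg_min_least[OF V(1,2)] unfolding v_def by blast+
  let ?W = "V - {v}"
  have cW: "real (card ?W) = real (card V) - 1" "card ?W = card V - 1"
    using V v by (simp_all add: of_nat_diff Suc_leI card_gt_0_iff)
  have "k = card ?W - s" "s \<le> card ?W" "finite ?W"
    using Suc.hyps(2) V cW(2) by auto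
  then obtain S where S: "S \<subseteq> ?W" "card S = s" "real s * sum D ?W \<le> real (card ?W) * sum D S"
    using Suc.hyps(1) by blast
  have "real (card V) * D v \<le> sum D V"
    using sum_bounded_below[of V "D v" D] vmin by simp
  then have "(real (card V) - 1) * sum D V \<le> real (card V) * sum D ?W"
    using V v by (simp add: sum_diff1 algebra_simps)
  then have "real s * ((real (card V) - 1) * sum D V) \<le> real s * (real (card V) * sum D ?W)"
    by (rule mult_left_mono) simp
  also have "\<dots> \<le> real (card V) * ((real (card V) - 1) * sum D S)"
    using mult_left_mono[OF S(3), of "real (card V)"] cW(1) by (simp add: algebra_simps)
  finally have *: "(real (card V) - 1) * (real s * sum D V) \<le> (real (card V) - 1) * (real (card V) * sum D S)"
    by (simp add: algebra_simps)
  show ?case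
  \<comment> \<open>For a singleton the factor \<open>card V - 1\<close> vanishes and cannot be
    cancelled; then \<open>s = 0\<close> and the empty set serves.\<close>
  proof (cases "card V = 1")
    case True
    then have "s = 0" using V by simp
    then show ?thesis by (intro exI[of _ "{}"]) auto
  next
    case False
    then have "0 < real (card V) - 1" using V by auto
    then have "real s * sum D V \<le> real (card V) * sum D S"
      using * by (simp only: mult_le_cancel_left_pos)
    then show ?thesis using S by auto
  qed
qed

text \<open>Here \<open>p\<close> is the power of a test and \<open>q\<close> its false alarm
  probability. The constant 3/4 is the minimum of \<open>1 - p + p\<^sup>2\<close>, attained at
  \<open>p = 1 / 2\<close>.\<close>

lemma test_error_lower_bound:
  fixes C p q :: real
  assumes "p\<^sup>2 \<le> C * q" and "1 \<le> C" and "0 \<le> p" "p \<le> 1"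
  shows "3 / (4 * C) \<le> (1 - p) + q"
proof -
  have "3 / 4 \<le> (1 - p) + p\<^sup>2"
    using zero_le_power2[of "p - 1 / 2"] by (simp add: power2_eq_square algebra_simps)
  also have "\<dots> \<le> C * (1 - p) + C * q"
    using assms mult_right_mono[of 1 C "1 - p"] by simp
  finally show ?thesis using assms by (simp add: field_simps)
qed

section \<open>Reduction of the selection risk to scalar tests\<close>

lemma CL_mechanisms_kernel:
  assumes "Q \<in> CL_mechanisms n d \<alpha>" "i < n" "j < d"
  shows "Q i j \<in> borel \<rightarrow>\<^sub>M prob_algebra borel"
  using assms by (auto simp: CL_mechanisms_def diff_private_def markov_kernel_def)

text \<open>All private outputs are independent: the rule for kernels acting factor by factor is
  applied first across observations and then across coordinates.\<close>

lemma private_law_eq_PiM: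
  assumes nu: "noise_law \<nu>" and Q: "Q \<in> CL_mechanisms n d \<alpha>"
  shows "private_law \<nu> \<sigma> n d Q \<theta> =
    PiM {..<n} (\<lambda>i. PiM {..<d} (\<lambda>j. channel_law \<nu> \<sigma> (Q i j) (\<theta> j)))"
proof -
  note K = CL_mechanisms_kernel[OF Q]
  let ?D = "\<lambda>j. distr \<nu> borel (\<lambda>x. \<theta> j + \<sigma> * x)"
  have nus: "prob_space \<nu>" "sets \<nu> = sets borel" using nu by (auto simp: noise_law_def)
  have D: "prob_space (?D j)" for j
    using channel_input_prob_algebra[OF nu] by (auto simp: space_prob_algebra)
  have "(\<lambda>x. \<theta> j + \<sigma> * x) \<in> \<nu> \<rightarrow>\<^sub>M borel" for j
    by (subst measurable_cong_sets[OF nus(2) refl]) measurable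
  then have obs: "obs_law \<nu> \<sigma> d \<theta> = PiM {..<d} ?D"
    unfolding obs_law_def obs_space_def using nus by (intro distr_PiM_componentwise) auto
  have inner: "(\<lambda>x. PiM {..<d} (\<lambda>j. Q i j (x j))) \<in> PiM {..<d} ?D \<rightarrow>\<^sub>M prob_algebra (PiM {..<d} (\<lambda>_. borel))"
    if "i < n" for i
    using K that by (intro measurable_PiM_kernel) auto
  have "private_law \<nu> \<sigma> n d Q \<theta> = PiM {..<n} (\<lambda>_. PiM {..<d} ?D) \<bind>
      (\<lambda>x. PiM {..<n} (\<lambda>i. PiM {..<d} (\<lambda>j. Q i j (x i j))))"
    by (simp add: private_law_def sample_law_def obs product_kernel_def[abs_def])
  also have "\<dots> = PiM {..<n} (\<lambda>i. PiM {..<d} ?D \<bind> (\<lambda>x. PiM {..<d} (\<lambda>j. Q i j (x j))))"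
    using inner D by (intro bind_PiM_kernel) (auto intro: prob_space_PiM)
  also have "\<dots> = PiM {..<n} (\<lambda>i. PiM {..<d} (\<lambda>j. channel_law \<nu> \<sigma> (Q i j) (\<theta> j)))"
    unfolding channel_law_def using K D by (intro PiM_cong refl bind_PiM_kernel) auto
  finally show ?thesis .
qed

text \<open>The law of the \<open>j\<close>-th column of the private sample. It depends on \<theta>
  only through \<open>\<theta> j\<close>, so changing the support elsewhere does not affect the test
  in this column.\<close>

definition marginal_law ::
  "real measure \<Rightarrow> real \<Rightarrow> nat \<Rightarrow> (nat \<Rightarrow> nat \<Rightarrow> real \<Rightarrow> real measure) \<Rightarrow> nat \<Rightarrow> real \<Rightarrow> (nat \<Rightarrow> real) measure" where
  "marginal_law \<nu> \<sigma> n Q j t = PiM {..<n} (\<lambda>i. channel_law \<nu> \<sigma> (Q i j) t)"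

context
  fixes \<nu> :: "real measure" and \<sigma> \<alpha> :: real and n d :: nat
    and Q :: "nat \<Rightarrow> nat \<Rightarrow> real \<Rightarrow> real measure" and h :: "(nat \<Rightarrow> nat \<Rightarrow> real) \<Rightarrow> nat \<Rightarrow> nat"
  assumes nu: "noise_law \<nu>" and Q: "Q \<in> CL_mechanisms n d \<alpha>"
begin

lemma channel_law_CL:
  assumes "i < n" "j < d"
  shows "prob_space (channel_law \<nu> \<sigma> (Q i j) t)" "sets (channel_law \<nu> \<sigma> (Q i j) t) = sets borel"
  using channel_law_prob_space[OF nu CL_mechanisms_kernel[OF Q assms]] by auto

lemma marginal_law_prob_space:
  assumes "j < d"
  shows "prob_space (marginal_law \<nu> \<sigma> n Q j t)"
    and "sets (marginal_law \<nu> \<sigma> n Q j t) = sets (PiM {..<n} (\<lambda>_. borel))"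
  unfolding marginal_law_def using channel_law_CL assms
  by (auto intro!: prob_space_PiM sets_PiM_cong)

lemma distr_private_law:
  assumes j: "j < d"
  shows "distr (private_law \<nu> \<sigma> n d Q \<theta>) (PiM {..<n} (\<lambda>_. borel)) (\<lambda>z. \<lambda>i\<in>{..<n}. z i j) =
    marginal_law \<nu> \<sigma> n Q j (\<theta> j)"
proof -
  let ?C = "\<lambda>i j. channel_law \<nu> \<sigma> (Q i j) (\<theta> j)"
  have "(\<lambda>x. x j) \<in> PiM {..<d} (?C i) \<rightarrow>\<^sub>M borel" if "i < n" for i
  proof -
    have "(\<lambda>x. x j) \<in> PiM {..<d} (?C i) \<rightarrow>\<^sub>M ?C i j"
      using j by (intro measurable_component_singleton) simp
    then show ?thesis
      by (simp only: measurable_cong_sets[OF refl channel_law_CL(2)[OF that j]])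
  qed
  then have "distr (private_law \<nu> \<sigma> n d Q \<theta>) (PiM {..<n} (\<lambda>_. borel)) (\<lambda>z. \<lambda>i\<in>{..<n}. z i j) =
      PiM {..<n} (\<lambda>i. distr (PiM {..<d} (?C i)) borel (\<lambda>x. x j))"
    unfolding private_law_eq_PiM[OF nu Q]
    using channel_law_CL by (intro distr_PiM_componentwise) (auto intro!: prob_space_PiM)
  also have "\<dots> = marginal_law \<nu> \<sigma> n Q j (\<theta> j)"
    unfolding marginal_law_def
  proof (intro PiM_cong refl)
    fix i assume "i \<in> {..<n}"
    then have "distr (PiM {..<d} (?C i)) borel (\<lambda>x. x j) = distr (PiM {..<d} (?C i)) (?C i j) (\<lambda>x. x j)"
      using channel_law_CL(2)[of i j] j by (intro distr_cong) auto
    also have "\<dots> = ?C i j"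
      using channel_law_CL \<open>i \<in> {..<n}\<close> j by (intro distr_PiM_component) auto
    finally show "distr (PiM {..<d} (?C i)) borel (\<lambda>x. x j) = channel_law \<nu> \<sigma> (Q i j) (\<theta> j)" .
  qed
  finally show ?thesis .
qed

text \<open>By separability, what is put into the coordinates other than \<open>j\<close> is irrelevant; copies of \<open>w\<close>
  keep the map measurable.\<close>

definition coordinate_test :: "nat \<Rightarrow> (nat \<Rightarrow> real) \<Rightarrow> nat" where
  "coordinate_test j w = h (\<lambda>i\<in>{..<n}. \<lambda>k\<in>{..<d}. w i) j"

lemma coordinate_test_measurable:
  assumes h: "h \<in> separable_selectors n d" and j: "j < d"
  shows "coordinate_test j \<in> PiM {..<n} (\<lambda>_. borel) \<rightarrow>\<^sub>M count_space {0, 1}"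
proof -
  have "h \<in> sample_space n d \<rightarrow>\<^sub>M PiM {..<d} (\<lambda>_. count_space {0, 1})"
    using h by (simp add: separable_selectors_def selectors_def)
  moreover have "(\<lambda>w. \<lambda>i\<in>{..<n}. \<lambda>k\<in>{..<d}. w i) \<in> PiM {..<n} (\<lambda>_. borel) \<rightarrow>\<^sub>M sample_space n d"
    unfolding sample_space_def obs_space_def by (intro measurable_restrict) auto
  moreover have "(\<lambda>x. x j) \<in> PiM {..<d} (\<lambda>_. count_space {0, 1 :: nat}) \<rightarrow>\<^sub>M count_space {0, 1}"
    using j by (intro measurable_component_singleton) auto
  ultimately show ?thesis
    unfolding coordinate_test_def[abs_def] by (auto intro: measurable_compose)
qed

lemma coordinate_test_sets:
  assumes h: "h \<in> separable_selectors n d" and j: "j < d"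
  shows "{w \<in> space (PiM {..<n} (\<lambda>_. borel)). coordinate_test j w \<noteq> v} \<in> sets (PiM {..<n} (\<lambda>_. borel))"
proof -
  let ?N = "PiM {..<n} (\<lambda>_. borel :: real measure)"
  note m = coordinate_test_measurable[OF h j]
  have "{w \<in> space ?N. coordinate_test j w \<noteq> v} = coordinate_test j -` ({0, 1} - {v}) \<inter> space ?N"
    using measurable_space[OF m] by fastforce
  then show ?thesis using measurable_sets[OF m, of "{0, 1} - {v}"] by simp
qed

text \<open>By separability each summand of the Hamming loss is the indicator of an event in a
  single column, so its expectation is a probability under the marginal law of that column.\<close>

lemma selection_risk_eq:
  assumes h: "h \<in> separable_selectors n d"
  shows "selection_risk \<nu> \<sigma> n d s Q h \<theta> = ennreal (1 / real s * (\<Sum>j<d.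
    measure (marginal_law \<nu> \<sigma> n Q j (\<theta> j))
      {w \<in> space (PiM {..<n} (\<lambda>_. borel)). coordinate_test j w \<noteq> support_ind \<theta> j}))"
proof -
  let ?L = "private_law \<nu> \<sigma> n d Q \<theta>" and ?N = "PiM {..<n} (\<lambda>_. borel :: real measure)"
  let ?W = "\<lambda>j. {w \<in> space ?N. coordinate_test j w \<noteq> support_ind \<theta> j}"
  let ?pr = "\<lambda>j z. \<lambda>i\<in>{..<n}. z i j"
  have sL: "sets ?L = sets (sample_space n d)"
    unfolding private_law_eq_PiM[OF nu Q] sample_space_def obs_space_def
    using channel_law_CL by (intro sets_PiM_cong refl) auto
  have spL: "space ?L = space (sample_space n d)"
    by (rule sets_eq_imp_space_eq[OF sL])
  have pr: "?pr j \<in> ?L \<rightarrow>\<^sub>M ?N" if "j < d" for j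
    unfolding measurable_cong_sets[OF sL refl] sample_space_def obs_space_def
    using that by (intro measurable_restrict measurable_compose[OF measurable_component_singleton]) auto
  have W: "?W j \<in> sets ?N" if "j < d" for j
    by (rule coordinate_test_sets[OF h that])
  have sep: "h z j = coordinate_test j (?pr j z)" if "j < d" "z \<in> space ?L" for j z
  proof -
    have "h z j = h (\<lambda>i\<in>{..<n}. \<lambda>k\<in>{..<d}. ?pr j z i) j"
    proof -
      \<comment> \<open>The sample \<open>?z\<close>, with column \<open>j\<close> copied
        everywhere, agrees with \<open>z\<close> in column \<open>j\<close>, which is all that
        separability looks at.\<close>
      let ?z = "\<lambda>i\<in>{..<n}. \<lambda>k\<in>{..<d}. ?pr j z i"
      have "?z \<in> space (sample_space n d)"
        by (auto simp: sample_space_def obs_space_def space_PiM)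
      moreover have "\<forall>i<n. z i j = ?z i j" using that by simp
      moreover have "z \<in> space (sample_space n d)" using that spL by simp
      ultimately show ?thesis
        using h \<open>j < d\<close> unfolding separable_selectors_def by blast
    qed
    then show ?thesis by (simp add: coordinate_test_def)
  qed
  have "(\<integral>\<^sup>+z. of_nat (hamming_loss d (h z) (support_ind \<theta>)) \<partial>?L) =
      (\<integral>\<^sup>+z. (\<Sum>j<d. indicator (?W j) (?pr j z)) \<partial>?L)"
  proof (rule nn_integral_cong)
    fix z assume z: "z \<in> space ?L"
    have *: "of_nat (if h z j \<noteq> support_ind \<theta> j then 1 else 0) = (indicator (?W j) (?pr j z) :: ennreal)"
      if "j \<in> {..<d}" for j
    proof -
      have "j < d" using that by simp
      then show ?thesis
        using sep[OF _ z, of j] measurable_space[OF pr z, of j] by (auto simp: indicator_def)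
    qed
    show "of_nat (hamming_loss d (h z) (support_ind \<theta>)) = (\<Sum>j<d. indicator (?W j) (?pr j z) :: ennreal)"
      unfolding hamming_loss_def of_nat_sum by (rule sum.cong[OF refl *])
  qed
  also have "\<dots> = (\<Sum>j<d. \<integral>\<^sup>+z. indicator (?W j) (?pr j z) \<partial>?L)"
    by (intro nn_integral_sum measurable_compose[OF pr borel_measurable_indicator[OF W]])
      simp_all
  also have "\<dots> = (\<Sum>j<d. emeasure (marginal_law \<nu> \<sigma> n Q j (\<theta> j)) (?W j))"
  proof (intro sum.cong refl)
    fix j assume "j \<in> {..<d}"
    then have j: "j < d" by simp
    have "(\<integral>\<^sup>+z. indicator (?W j) (?pr j z) \<partial>?L) = (\<integral>\<^sup>+w. indicator (?W j) w \<partial>distr ?L ?N (?pr j))"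
      using W[OF j] by (intro nn_integral_distr[OF pr[OF j], symmetric]) simp
    also have "\<dots> = emeasure (distr ?L ?N (?pr j)) (?W j)"
      using W[OF j] by (intro nn_integral_indicator) simp
    finally show "(\<integral>\<^sup>+z. indicator (?W j) (?pr j z) \<partial>?L) =
        emeasure (marginal_law \<nu> \<sigma> n Q j (\<theta> j)) (?W j)"
      unfolding distr_private_law[OF j] .
  qed
  also have "\<dots> = (\<Sum>j<d. ennreal (measure (marginal_law \<nu> \<sigma> n Q j (\<theta> j)) (?W j)))"
    using marginal_law_prob_space(1)
    by (intro sum.cong refl finite_measure.emeasure_eq_measure prob_space.finite_measure) auto
  also have "\<dots> = ennreal (\<Sum>j<d. measure (marginal_law \<nu> \<sigma> n Q j (\<theta> j)) (?W j))"
    by (rule sum_ennreal) simp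
  finally show ?thesis
    unfolding selection_risk_def by (simp only:) (rule ennreal_mult'[symmetric], simp)
qed

text \<open>The test in column \<open>j\<close> has to tell \<open>a\<close> from 0 on the basis of
  \<open>n\<close> independent outputs, whose domination constant is the \<open>n\<close>-th power
  of that of one channel.\<close>

lemma coordinate_test_error:
  assumes h: "h \<in> separable_selectors n d" and j: "j < d"
    and phi: "log_concave_potential \<nu> \<phi>" and \<sigma>: "0 < \<sigma>" and a: "0 < a" and \<alpha>: "0 \<le> \<alpha>"
    and C: "(1 + ((exp (\<alpha> / real d) - 1) * min 1 (a / \<sigma> * exp (- \<phi> 0)))\<^sup>2) ^ n \<le> C"
  shows "3 / (4 * C) \<le>
    measure (marginal_law \<nu> \<sigma> n Q j a)
      {w \<in> space (PiM {..<n} (\<lambda>_. borel)). coordinate_test j w \<noteq> 1} +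
    measure (marginal_law \<nu> \<sigma> n Q j 0)
      {w \<in> space (PiM {..<n} (\<lambda>_. borel)). coordinate_test j w \<noteq> 0}"
proof -
  let ?N = "PiM {..<n} (\<lambda>_. borel :: real measure)"
  let ?P = "\<lambda>t. marginal_law \<nu> \<sigma> n Q j t"
  let ?W = "\<lambda>v. {w \<in> space ?N. coordinate_test j w \<noteq> v}"
  let ?B = "1 + ((exp (\<alpha> / real d) - 1) * min 1 (a / \<sigma> * exp (- \<phi> 0)))\<^sup>2"
  interpret Pa: prob_space "?P a" by (rule marginal_law_prob_space[OF j])
  interpret P0: prob_space "?P 0" by (rule marginal_law_prob_space[OF j])
  have s: "sets (?P t) = sets ?N" for t by (rule marginal_law_prob_space[OF j])
  have sp: "space (?P t) = space ?N" for t by (rule sets_eq_imp_space_eq[OF s])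
  have W: "?W v \<in> sets ?N" for v
    by (rule coordinate_test_sets[OF h j])
  have WP: "?W v \<in> sets (?P t)" for v t
    by (simp only: s W)
  have "square_dominated (?B ^ card {..<n}) (?P a) (?P 0)"
    unfolding marginal_law_def
  proof (rule square_dominated_PiM)
    fix i assume "i \<in> {..<n}"
    then have "diff_private (\<alpha> / real d) borel borel (Q i j)"
      using Q j by (auto simp: CL_mechanisms_def)
    then show "square_dominated ?B (channel_law \<nu> \<sigma> (Q i j) a) (channel_law \<nu> \<sigma> (Q i j) 0)"
      using \<alpha> by (intro private_channel_square_dominated nu phi \<sigma> a) auto
  qed (use channel_law_CL j in auto)
  from square_dominated_measure[OF this WP]
  have "(measure (?P a) (?W 0))\<^sup>2 \<le> ?B ^ n * measure (?P 0) (?W 0)"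
    by (simp only: card_lessThan)
  also have "\<dots> \<le> C * measure (?P 0) (?W 0)"
    by (rule mult_right_mono[OF C]) simp
  finally have "3 / (4 * C) \<le> (1 - measure (?P a) (?W 0)) + measure (?P 0) (?W 0)"
    \<comment> \<open>The power of \<open>?B\<close> is at least 1, hence so is \<open>C\<close>, as
      the testing bound demands.\<close>
    using order_trans[OF one_le_power[of ?B n] C]
    by (intro test_error_lower_bound) auto
  also have "1 - measure (?P a) (?W 0) = measure (?P a) (space (?P a) - ?W 0)"
    by (rule Pa.prob_compl[OF WP, symmetric])
  also have "\<dots> \<le> measure (?P a) (?W 1)"
    by (rule Pa.finite_measure_mono[OF _ WP]) (auto simp: sp)
  finally show ?thesis by simp
qed

text \<open>With misses \<open>A j\<close> and false alarms \<open>B j\<close>, a support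
  \<open>S\<close> has total error \<open>\<Sum>j<d. B j\<close> plus
  \<open>\<Sum>j\<in>S. A j - B j\<close>. Some \<open>S\<close> of size \<open>s\<close> makes the
  second sum at least \<open>s / d\<close> times the sum over all coordinates. After division by
  \<open>s\<close>, the average over coordinates of \<open>A j + (d / s - 1) * B j\<close>
  remains.\<close>

lemma exists_sparse_signal_risk_ge:
  assumes h: "h \<in> separable_selectors n d"
    and phi: "log_concave_potential \<nu> \<phi>" and \<sigma>: "0 < \<sigma>" and a: "0 < a" and \<alpha>: "0 \<le> \<alpha>"
    and C: "(1 + ((exp (\<alpha> / real d) - 1) * min 1 (a / \<sigma> * exp (- \<phi> 0)))\<^sup>2) ^ n \<le> C"
    and s: "1 \<le> s" "s \<le> d" and C0: "0 < C0" "C0 < 1" "real s / real d \<le> C0"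
  shows "\<exists>\<theta>\<in>Theta_plus d s a.
    ennreal (min 1 (1 / C0 - 1) * (3 / (4 * C))) \<le> selection_risk \<nu> \<sigma> n d s Q h \<theta>"
proof -
  let ?N = "PiM {..<n} (\<lambda>_. borel :: real measure)"
  define A where "A j = measure (marginal_law \<nu> \<sigma> n Q j a) {w \<in> space ?N. coordinate_test j w \<noteq> 1}" for j
  define B where "B j = measure (marginal_law \<nu> \<sigma> n Q j 0) {w \<in> space ?N. coordinate_test j w \<noteq> 0}" for j
  let ?c = "3 / (4 * C)" and ?\<kappa> = "min 1 (1 / C0 - 1)"
  have nonneg: "0 \<le> A j" "0 \<le> B j" for j by (auto simp: A_def B_def)
  have AB: "?c \<le> A j + B j" if "j < d" for j
    unfolding A_def B_def by (rule coordinate_test_error[OF h that phi \<sigma> a \<alpha> C])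
  obtain S where S: "S \<subseteq> {..<d}" "card S = s"
    and avg: "real s * (\<Sum>j<d. A j - B j) \<le> real d * (\<Sum>j\<in>S. A j - B j)"
    using exists_subset_sum_ge_average[of "{..<d}" s "\<lambda>j. A j - B j"] s by auto
  define \<theta> where "\<theta> = (\<lambda>j\<in>{..<d}. if j \<in> S then a else 0)"
  have \<theta>: "\<theta> \<in> Theta_plus d s a"
    unfolding Theta_plus_def using S by (auto simp: \<theta>_def intro!: exI[of _ S])
  have d0: "0 < real d" "0 < real s" using s by auto
  have "real d * (?\<kappa> * ?c) = ?\<kappa> * (\<Sum>j<d. ?c)" by simp
  also have "\<dots> \<le> ?\<kappa> * (\<Sum>j<d. A j + B j)"
    using AB C0 by (intro mult_left_mono sum_mono) auto
  also have "\<dots> = (\<Sum>j<d. ?\<kappa> * A j + ?\<kappa> * B j)"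
    by (simp add: sum_distrib_left distrib_left)
  \<comment> \<open>The factor \<open>?\<kappa>\<close> lies below both weights 1 and
    \<open>d / s - 1\<close>, because \<open>d / s \<ge> 1 / C0\<close>; it is positive since
    \<open>C0 < 1\<close>.\<close>
  also have "\<dots> \<le> (\<Sum>j<d. A j + (real d / real s - 1) * B j)"
  proof (intro sum_mono add_mono)
    have "1 / C0 \<le> real d / real s" using C0 d0 by (simp add: field_simps)
    then show "?\<kappa> * B j \<le> (real d / real s - 1) * B j" for j
      using nonneg by (intro mult_right_mono) auto
    show "?\<kappa> * A j \<le> A j" for j
      using mult_right_mono[of ?\<kappa> 1 "A j"] nonneg by simp
  qed
  also have "\<dots> = (1 / real s) * (real d * (\<Sum>j<d. B j) + real s * (\<Sum>j<d. A j - B j))"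
  proof -
    have "A j + (real d / real s - 1) * B j = (1 / real s) * (real d * B j + real s * (A j - B j))" for j
      using d0 by (simp add: field_simps)
    then show ?thesis
      by (simp only: sum_distrib_left sum.distrib distrib_left)
  qed
  also have "\<dots> \<le> (1 / real s) * (real d * (\<Sum>j<d. B j) + real d * (\<Sum>j\<in>S. A j - B j))"
    using avg d0 by (intro mult_left_mono) auto
  also have "\<dots> = real d * (1 / real s * ((\<Sum>j<d. B j) + (\<Sum>j\<in>S. A j - B j)))"
    by (simp add: algebra_simps)
  also have "(\<Sum>j<d. B j) + (\<Sum>j\<in>S. A j - B j) = (\<Sum>j<d. if j \<in> S then A j else B j)"
  proof -
    have "(\<Sum>j\<in>S. A j - B j) = (\<Sum>j<d. if j \<in> S then A j - B j else 0)"
      using S by (simp add: sum.If_cases Int_absorb1)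
    then show ?thesis by (simp add: sum.distrib[symmetric] if_distrib cong: if_cong sum.cong)
  qed
  finally have "?\<kappa> * ?c \<le> 1 / real s * (\<Sum>j<d. if j \<in> S then A j else B j)"
    using d0 by (simp only: mult_le_cancel_left_pos)
  also have "(\<Sum>j<d. if j \<in> S then A j else B j) = (\<Sum>j<d. measure (marginal_law \<nu> \<sigma> n Q j (\<theta> j))
      {w \<in> space ?N. coordinate_test j w \<noteq> support_ind \<theta> j})"
    using a by (intro sum.cong refl) (auto simp: A_def B_def \<theta>_def support_ind_def)
  finally show ?thesis
    using \<theta> selection_risk_eq[OF h] by (intro bexI[of _ \<theta>]) (auto intro: ennreal_leI)
qed

end

section \<open>The minimax bound, uniformly in the dimension\<close>

lemma CL_minimax_risk_Theta_plus_ge: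
  assumes "noise_law \<nu>" "log_concave_potential \<nu> \<phi>" "0 < \<sigma>" "0 < a" "0 \<le> \<alpha>"
    and "(1 + ((exp (\<alpha> / real d) - 1) * min 1 (a / \<sigma> * exp (- \<phi> 0)))\<^sup>2) ^ n \<le> C"
    and "1 \<le> s" "s \<le> d" and "0 < C0" "C0 < 1" "real s / real d \<le> C0"
  shows "ennreal (min 1 (1 / C0 - 1) * (3 / (4 * C))) \<le>
    CL_minimax_risk \<nu> \<sigma> n d s \<alpha> (Theta_plus d s a)"
  unfolding CL_minimax_risk_def
proof (intro INF_greatest)
  fix Q h assume "Q \<in> CL_mechanisms n d \<alpha>" "h \<in> separable_selectors n d"
  then obtain \<theta> where "\<theta> \<in> Theta_plus d s a"
    "ennreal (min 1 (1 / C0 - 1) * (3 / (4 * C))) \<le> selection_risk \<nu> \<sigma> n d s Q h \<theta>"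
    using exists_sparse_signal_risk_ge assms by blast
  then show "ennreal (min 1 (1 / C0 - 1) * (3 / (4 * C))) \<le>
      (SUP \<theta>\<in>Theta_plus d s a. selection_risk \<nu> \<sigma> n d s Q h \<theta>)"
    by (rule SUP_upper2[of \<theta>])
qed

lemma CL_minimax_risk_mono:
  assumes "T \<subseteq> T'"
  shows "CL_minimax_risk \<nu> \<sigma> n d s \<alpha> T \<le> CL_minimax_risk \<nu> \<sigma> n d s \<alpha> T'"
  unfolding CL_minimax_risk_def
  by (intro INF_mono' SUP_subset_mono assms order_refl)

lemma Theta_plus_subset_Theta:
  assumes "0 \<le> a"
  shows "Theta_plus d s a \<subseteq> Theta d s a"
  unfolding Theta_plus_def Theta_def using assms by (fastforce simp: abs_if)

text \<open>For \<open>\<epsilon> \<le> E\<close> the quantity \<open>exp \<epsilon> - 1\<close> is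
  at most \<open>\<epsilon> * exp E\<close>, and \<open>1 + x \<le> exp x\<close> turns the power
  into the exponential of a sum. The resulting bound involves \<open>E\<close> and \<open>L\<close>
  alone.\<close>

lemma privacy_budget_power_le:
  fixes \<epsilon> E \<tau> L :: real
  assumes "0 \<le> \<epsilon>" "\<epsilon> \<le> E" and L: "real n * \<epsilon>\<^sup>2 * \<tau>\<^sup>2 \<le> L"
  shows "(1 + ((exp \<epsilon> - 1) * \<tau>)\<^sup>2) ^ n \<le> exp ((exp E)\<^sup>2 * L)"
proof -
  have "1 - \<epsilon> \<le> exp (- \<epsilon>)" using exp_ge_add_one_self[of "- \<epsilon>"] by simp
  then have "(1 - \<epsilon>) * exp \<epsilon> \<le> 1"
    using mult_right_mono[of "1 - \<epsilon>" "exp (- \<epsilon>)" "exp \<epsilon>"] by (simp add: exp_minus)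
  then have "exp \<epsilon> - 1 \<le> \<epsilon> * exp \<epsilon>" by (simp add: algebra_simps)
  also have "\<dots> \<le> \<epsilon> * exp E" using assms by (intro mult_left_mono) auto
  finally have "(exp \<epsilon> - 1)\<^sup>2 \<le> (\<epsilon> * exp E)\<^sup>2"
    using assms by (intro power_mono) auto
  then have "((exp \<epsilon> - 1) * \<tau>)\<^sup>2 \<le> (\<epsilon> * exp E)\<^sup>2 * \<tau>\<^sup>2"
    by (simp add: power_mult_distrib mult_right_mono)
  then have *: "real n * ((exp \<epsilon> - 1) * \<tau>)\<^sup>2 \<le> real n * ((\<epsilon> * exp E)\<^sup>2 * \<tau>\<^sup>2)"
    by (rule mult_left_mono) simp
  have "(1 + ((exp \<epsilon> - 1) * \<tau>)\<^sup>2) ^ n \<le> exp (((exp \<epsilon> - 1) * \<tau>)\<^sup>2) ^ n"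
    by (intro power_mono exp_ge_add_one_self) auto
  also have "\<dots> = exp (real n * ((exp \<epsilon> - 1) * \<tau>)\<^sup>2)"
    by (rule exp_of_nat_mult[symmetric])
  also have "\<dots> \<le> exp ((exp E)\<^sup>2 * L)"
  proof -
    have "real n * ((\<epsilon> * exp E)\<^sup>2 * \<tau>\<^sup>2) = (exp E)\<^sup>2 * (real n * \<epsilon>\<^sup>2 * \<tau>\<^sup>2)"
      by (simp add: power_mult_distrib)
    also have "\<dots> \<le> (exp E)\<^sup>2 * L"
      by (rule mult_left_mono[OF L]) simp
    finally show ?thesis using * by simp
  qed
  finally show ?thesis .
qed

theorem corollary2p2:
  fixes c_plus :: real
  assumes "c_plus > 0"
  shows "\<exists>C2>0. \<forall>(\<nu> :: real measure) (\<phi> :: real \<Rightarrow> real) (\<sigma> :: real) (C0 :: real) (d0 :: nat)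
      (\<alpha> :: nat \<Rightarrow> real) (a :: nat \<Rightarrow> real) (s :: nat \<Rightarrow> nat) (n :: nat \<Rightarrow> nat).
    noise_law \<nu> \<longrightarrow> log_concave_potential \<nu> \<phi> \<longrightarrow> semiconcave c_plus \<phi> \<longrightarrow>
    \<sigma> > 0 \<longrightarrow> 0 < C0 \<longrightarrow> C0 < 1 \<longrightarrow>
    (\<forall>d\<ge>d0. \<alpha> d > 0 \<and> a d > 0 \<and> 1 \<le> s d \<and> s d \<le> d \<and> 1 \<le> n d \<and> real (s d) / real d \<le> C0) \<longrightarrow>
    (\<lambda>d. \<alpha> d / real d) \<longlonglongrightarrow> 0 \<longrightarrow>
    ((\<exists>C1>0. \<forall>d\<ge>d0. real (n d) * (\<alpha> d)\<^sup>2 / (real d)\<^sup>2 \<le> C1) \<or>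
     (filterlim (\<lambda>d. real (n d) * (\<alpha> d)\<^sup>2 / (real d)\<^sup>2) at_top sequentially \<and>
      (\<forall>d\<ge>d0. (a d)\<^sup>2 \<le> C2 * \<sigma>\<^sup>2 * (real d)\<^sup>2 / (real (n d) * (\<alpha> d)\<^sup>2)))) \<longrightarrow>
    (\<exists>C>0. \<forall>d\<ge>d0.
       ennreal C \<le> CL_minimax_risk \<nu> \<sigma> (n d) d (s d) (\<alpha> d) (Theta_plus d (s d) (a d)) \<and>
       ennreal C \<le> CL_minimax_risk \<nu> \<sigma> (n d) d (s d) (\<alpha> d) (Theta d (s d) (a d)))"
proof (rule exI[of _ 1], intro conjI allI impI zero_less_one)
  \<comment> \<open>The witness for \<open>C2\<close> is 1; in case (ii) its value merely scales the
    bound \<open>L\<close> below.\<close>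
  fix \<nu> :: "real measure" and \<phi> :: "real \<Rightarrow> real" and \<sigma> C0 :: real and d0 :: nat
    and \<alpha> a :: "nat \<Rightarrow> real" and s n :: "nat \<Rightarrow> nat"
  assume nu: "noise_law \<nu>" and phi: "log_concave_potential \<nu> \<phi>"
    and \<sigma>: "\<sigma> > 0" and C0: "0 < C0" "C0 < 1"
    and reg: "\<forall>d\<ge>d0. \<alpha> d > 0 \<and> a d > 0 \<and> 1 \<le> s d \<and> s d \<le> d \<and> 1 \<le> n d \<and> real (s d) / real d \<le> C0"
    and lim: "(\<lambda>d. \<alpha> d / real d) \<longlonglongrightarrow> 0"
    and cases: "(\<exists>C1>0. \<forall>d\<ge>d0. real (n d) * (\<alpha> d)\<^sup>2 / (real d)\<^sup>2 \<le> C1) \<or>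
     (filterlim (\<lambda>d. real (n d) * (\<alpha> d)\<^sup>2 / (real d)\<^sup>2) at_top sequentially \<and>
      (\<forall>d\<ge>d0. (a d)\<^sup>2 \<le> 1 * \<sigma>\<^sup>2 * (real d)\<^sup>2 / (real (n d) * (\<alpha> d)\<^sup>2)))"
  let ?\<tau> = "\<lambda>d. min 1 (a d / \<sigma> * exp (- \<phi> 0))"
  \<comment> \<open>A convergent sequence is bounded, which yields one \<open>E\<close> for all
    \<open>d\<close>.\<close>
  obtain E where E: "\<And>d. \<bar>\<alpha> d / real d\<bar> \<le> E"
    using convergent_imp_Bseq[OF convergentI[OF lim]] by (auto simp: Bseq_def)
  obtain L where L: "\<And>d. d \<ge> d0 \<Longrightarrow> real (n d) * (\<alpha> d / real d)\<^sup>2 * (?\<tau> d)\<^sup>2 \<le> L"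
    using cases
  proof (elim disjE exE conjE)
    fix C1 assume C1: "C1 > 0" "\<forall>d\<ge>d0. real (n d) * (\<alpha> d)\<^sup>2 / (real d)\<^sup>2 \<le> C1"
    \<comment> \<open>Case (i): the privacy budget itself is bounded, and
      \<open>?\<tau> d \<le> 1\<close> for every size of the signal.\<close>
    have "real (n d) * (\<alpha> d / real d)\<^sup>2 * (?\<tau> d)\<^sup>2 \<le> C1" if "d \<ge> d0" for d
    proof -
      have "0 \<le> ?\<tau> d" using reg that \<sigma> by (simp add: less_imp_le)
      then have "(?\<tau> d)\<^sup>2 \<le> 1" by (intro power_le_one) auto
      then have "real (n d) * (\<alpha> d / real d)\<^sup>2 * (?\<tau> d)\<^sup>2 \<le> real (n d) * (\<alpha> d / real d)\<^sup>2 * 1"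
        by (intro mult_left_mono) auto
      then show ?thesis using C1(2) that by (fastforce simp: power_divide)
    qed
    then show ?thesis by (rule that)
  next
    assume a2: "\<forall>d\<ge>d0. (a d)\<^sup>2 \<le> 1 * \<sigma>\<^sup>2 * (real d)\<^sup>2 / (real (n d) * (\<alpha> d)\<^sup>2)"
    \<comment> \<open>Case (ii): the other argument of the minimum is used. The bound on
      \<open>(a d)\<^sup>2\<close> cancels the privacy budget and leaves the squared density at 0,
      which is free of \<open>d\<close>.\<close>
    have "real (n d) * (\<alpha> d / real d)\<^sup>2 * (?\<tau> d)\<^sup>2 \<le> (exp (- \<phi> 0))\<^sup>2" if "d \<ge> d0" for d
    proof -
      have pos: "0 < \<alpha> d" "0 < a d" "0 < real d" "0 < real (n d)"
        using reg[rule_format, OF that] by auto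
      let ?k = "real (n d) * (\<alpha> d / real d)\<^sup>2"
      have "(?\<tau> d)\<^sup>2 \<le> (a d / \<sigma> * exp (- \<phi> 0))\<^sup>2"
        using pos \<sigma> by (intro power_mono) auto
      then have "?k * (?\<tau> d)\<^sup>2 \<le> ?k * (a d / \<sigma> * exp (- \<phi> 0))\<^sup>2"
        by (rule mult_left_mono) simp
      also have "\<dots> = (?k * (a d)\<^sup>2 / \<sigma>\<^sup>2) * (exp (- \<phi> 0))\<^sup>2"
        by (simp add: power_mult_distrib power_divide)
      also have "\<dots> \<le> 1 * (exp (- \<phi> 0))\<^sup>2"
        using a2[rule_format, OF that] pos \<sigma>
        by (intro mult_right_mono) (auto simp: power_divide field_simps)
      finally show ?thesis by simp
    qed
    then show ?thesis by (rule that)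
  qed
  define M where "M = exp ((exp E)\<^sup>2 * L)"
  show "\<exists>C>0. \<forall>d\<ge>d0.
       ennreal C \<le> CL_minimax_risk \<nu> \<sigma> (n d) d (s d) (\<alpha> d) (Theta_plus d (s d) (a d)) \<and>
       ennreal C \<le> CL_minimax_risk \<nu> \<sigma> (n d) d (s d) (\<alpha> d) (Theta d (s d) (a d))"
  proof (intro exI[of _ "min 1 (1 / C0 - 1) * (3 / (4 * M))"] conjI allI impI)
    show "0 < min 1 (1 / C0 - 1) * (3 / (4 * M))"
      using C0 by (simp add: M_def)
    fix d assume d: "d \<ge> d0"
    have "(1 + ((exp (\<alpha> d / real d) - 1) * ?\<tau> d)\<^sup>2) ^ n d \<le> M"
      unfolding M_def using reg[rule_format, OF d] E[of d] L[OF d]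
      by (intro privacy_budget_power_le) auto
    then show *: "ennreal (min 1 (1 / C0 - 1) * (3 / (4 * M))) \<le>
        CL_minimax_risk \<nu> \<sigma> (n d) d (s d) (\<alpha> d) (Theta_plus d (s d) (a d))"
      using reg[rule_format, OF d] nu phi \<sigma> C0
      by (intro CL_minimax_risk_Theta_plus_ge) auto
    show "ennreal (min 1 (1 / C0 - 1) * (3 / (4 * M))) \<le>
        CL_minimax_risk \<nu> \<sigma> (n d) d (s d) (\<alpha> d) (Theta d (s d) (a d))"
      using reg[rule_format, OF d]
      by (intro order_trans[OF * CL_minimax_risk_mono] Theta_plus_subset_Theta) auto
  qed
qed

end
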